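(* Let $n \in \mathbb{N}$ and let $\widehat{d}$ be a dissimilarity function on finite $n$-dimensional signed barcodes. Assume that $\widehat{d}$ is stable and balanced, and that it satisfies the triangle inequality. Then, for all finitely presentable $M,N : \mathbf{R}^n \to \mathbf{vec}$ with $d_I(M,N) < \infty$, we have $\widehat{d}(\beta\mathcal{B}(M), \beta\mathcal{B}(N)) = 0$.
   Context: Fix a field $\mathbb{k}$. $\mathbf{vec}$ is the category of finite-dimensional $\mathbb{k}$-vector spaces. $\mathbf{R}^n$ is the set $\mathbb{R}^n$ with the product order, viewed as a category. An $n$-parameter persistence module is a functor $\mathbf{R}^n \to \mathbf{vec}$; morphisms are natural transformations. Barcodes: an $n$-dimensional barcode is a multiset of elements of $\mathbb{R}^n$; a signed barcode is an ordered pair $(\mathcal{B}_+,\mathcal{B}_-)$ of barcodes. Multisets are considered up to isomorphism; $\cup$ is disjoint union of multisets (multiplicities add). A dissimilarity function on a set $A$ is a symmetric function $A\times A \to [0,\infty]$ that vanishes on all pairs $(a,a)$. A dissimilarity $\widehat{d}$ on finite signed barcodes is balanced if $\widehat{d}\big((\mathcal{B}_+, \mathcal{B}_- \cup \mathcal{D}), (\mathcal{C}_+, \mathcal{C}_-)\big) = \widehat{d}\big((\mathcal{B}_+, \mathcal{B}_-), (\mathcal{C}_+ \cup \mathcal{D}, \mathcal{C}_-)\big)$ for all finite signed barcodes $(\mathcal{B}_+,\mathcal{B}_-)$, $(\mathcal{C}_+,\mathcal{C}_-)$ and finite barcodes $\mathcal{D}$. It is stable if $\widehat{d}(\beta\mathcal{B}(M),\beta\mathcal{B}(N))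 \leq d_I(M,N)$ for all finitely presentable $n$-parameter persistence modules $M,N$, with the following notation. Interleaving distance: for real $\epsilon \geq 0$, $M[\epsilon](r) = M(r+(\epsilon,\dots,\epsilon))$ with the evident structure maps, and $\iota^M_\epsilon : M \to M[\epsilon]$ is given by the structure maps of $M$. $M$ and $N$ are $\epsilon$-interleaved if there are $f : M \to N[\epsilon]$ and $g : N \to M[\epsilon]$ with $g[\epsilon]\circ f = \iota^M_{2\epsilon}$ and $f[\epsilon]\circ g = \iota^N_{2\epsilon}$. $d_I(M,N) \in [0,\infty]$ is the infimum of the $\epsilon\ge 0$ such that $M,N$ are $\epsilon$-interleaved. Betti signed barcode: for $i \in \mathbb{R}^n$, $F_i$ is $\mathbb{k}$ on $\{j : j \geq i\}$ and $0$ elsewhere, with identity structure maps inside the support. A module is free if it is a direct sum of modules $F_i$; the barcode $\mathcal{B}(P)$ of a free module is the unique multiset with $P \cong \bigoplus_{i \in \mathcal{B}(P)} F_i$, and its cardinality is the rank of $P$. A module is finitely presentable if it is the cokernel of a morphism between free modules of finite rank. Every finitely presentable $M$ has a minimal projective resolution $P_\bullet \to M$ (each $P_k$ is free of minimal rank among all possible $k$-th terms of projective resolutions of $M$), unique up to isomorphism and of finite length. $\beta\mathcal{B}(M) = \big(\bigcup_{k \text{ even}} \mathcal{B}(P_k), \bigcup_{k \text{ odd}} \mathcal{B}(P_k)\big)$. *)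

theory Defs
  imports
    Complex_Main
    "HOL-Library.Multiset"
    "HOL-Library.Function_Algebras"
    "HOL-Library.Extended_Nonnegative_Real"
    "Jordan_Normal_Form.Matrix"
begin

section \<open>The poset \<open>\<real>\<^sup>n\<close>\<close>

text \<open>
  The set \<open>\<real>\<^sup>n\<close> is the carrier of real vectors of length \<open>n\<close>, so that \<open>n\<close> is an arbitrary natural
  number (including \<open>0\<close>). The order on this vector type is the product order.
\<close>

abbreviation Rn :: "nat \<Rightarrow> real vec set" where
  "Rn n \<equiv> carrier_vec n"

definition diag :: "nat \<Rightarrow> real \<Rightarrow> real vec" where
  "diag n \<epsilon> = vec n (\<lambda>_. \<epsilon>)"


section \<open>Finite-dimensional vector spaces\<close>

text \<open>
  The category of finite-dimensional vector spaces over the field \<open>'k\<close> is realised by the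
  finite-dimensional subspaces of the infinite-dimensional space \<open>nat \<Rightarrow> 'k\<close>. Every
  finite-dimensional space is isomorphic to one of these. Linear maps are HOL functions of which
  only the values on the source space are relevant; equality of morphisms is therefore always
  stated pointwise on the source.
\<close>

definition vscale :: "'k::field \<Rightarrow> (nat \<Rightarrow> 'k) \<Rightarrow> (nat \<Rightarrow> 'k)" where
  "vscale c v = (\<lambda>i. c * v i)"

interpretation kvs: vector_space "vscale :: 'k::field \<Rightarrow> _"
  by unfold_locales (auto simp: vscale_def fun_eq_iff algebra_simps)

definition fd_space :: "(nat \<Rightarrow> 'k::field) set \<Rightarrow> bool" where
  "fd_space V \<longleftrightarrow> kvs.subspace V \<and> (\<exists>B. finite B \<and> kvs.span B = V)"

definition linear_map ::
  "(nat \<Rightarrow> 'k::field) set \<Rightarrow> (nat \<Rightarrow> 'k) set \<Rightarrow> ((nat \<Rightarrow> 'k) \<Rightarrow> (nat \<Rightarrow> 'k)) \<Rightarrow> bool" where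
  "linear_map V W f \<longleftrightarrow>
     (\<forall>x\<in>V. f x \<in> W) \<and>
     (\<forall>x\<in>V. \<forall>y\<in>V. f (x + y) = f x + f y) \<and>
     (\<forall>c. \<forall>x\<in>V. f (vscale c x) = vscale c (f x))"


section \<open>Persistence modules\<close>

record 'k pmod =
  obj :: "real vec \<Rightarrow> (nat \<Rightarrow> 'k) set"
  str :: "real vec \<Rightarrow> real vec \<Rightarrow> (nat \<Rightarrow> 'k) \<Rightarrow> (nat \<Rightarrow> 'k)"

type_synonym 'k pmor = "real vec \<Rightarrow> (nat \<Rightarrow> 'k) \<Rightarrow> (nat \<Rightarrow> 'k)"

definition persistence_module :: "nat \<Rightarrow> 'k::field pmod \<Rightarrow> bool" where
  "persistence_module n M \<longleftrightarrow>
     (\<forall>r\<in>Rn n. fd_space (obj M r)) \<and>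
     (\<forall>r\<in>Rn n. \<forall>s\<in>Rn n. r \<le> s \<longrightarrow> linear_map (obj M r) (obj M s) (str M r s)) \<and>
     (\<forall>r\<in>Rn n. \<forall>x\<in>obj M r. str M r r x = x) \<and>
     (\<forall>r\<in>Rn n. \<forall>s\<in>Rn n. \<forall>t\<in>Rn n. r \<le> s \<longrightarrow> s \<le> t \<longrightarrow>
        (\<forall>x\<in>obj M r. str M s t (str M r s x) = str M r t x))"

text \<open>Natural transformations.\<close>

definition pmod_hom :: "nat \<Rightarrow> 'k::field pmod \<Rightarrow> 'k pmod \<Rightarrow> 'k pmor \<Rightarrow> bool" where
  "pmod_hom n M N f \<longleftrightarrow>
     (\<forall>r\<in>Rn n. linear_map (obj M r) (obj N r) (f r)) \<and>
     (\<forall>r\<in>Rn n. \<forall>s\<in>Rn n. r \<le> s \<longrightarrow>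
        (\<forall>x\<in>obj M r. f s (str M r s x) = str N r s (f r x)))"

definition pmod_iso :: "nat \<Rightarrow> 'k::field pmod \<Rightarrow> 'k pmod \<Rightarrow> bool" where
  "pmod_iso n M N \<longleftrightarrow>
     (\<exists>f g. pmod_hom n M N f \<and> pmod_hom n N M g \<and>
        (\<forall>r\<in>Rn n. \<forall>x\<in>obj M r. g r (f r x) = x) \<and>
        (\<forall>r\<in>Rn n. \<forall>y\<in>obj N r. f r (g r y) = y))"

text \<open>
  Epimorphisms and exactness in the functor category are pointwise.
\<close>

definition pmod_epi :: "nat \<Rightarrow> 'k::field pmod \<Rightarrow> 'k pmod \<Rightarrow> 'k pmor \<Rightarrow> bool" where
  "pmod_epi n M N f \<longleftrightarrow> pmod_hom n M N f \<and> (\<forall>r\<in>Rn n. f r ` obj M r = obj N r)"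

definition exact_at :: "nat \<Rightarrow> 'k::field pmod \<Rightarrow> 'k pmor \<Rightarrow> 'k pmod \<Rightarrow> 'k pmor \<Rightarrow> bool" where
  "exact_at n L f M g \<longleftrightarrow> (\<forall>r\<in>Rn n. f r ` obj L r = {x \<in> obj M r. g r x = 0})"


section \<open>Interleaving distance\<close>

definition shift :: "nat \<Rightarrow> real \<Rightarrow> 'k::field pmod \<Rightarrow> 'k pmod" where
  "shift n \<epsilon> M =
     \<lparr>obj = (\<lambda>r. obj M (r + diag n \<epsilon>)),
      str = (\<lambda>r s. str M (r + diag n \<epsilon>) (s + diag n \<epsilon>))\<rparr>"

definition interleaved :: "nat \<Rightarrow> real \<Rightarrow> 'k::field pmod \<Rightarrow> 'k pmod \<Rightarrow> bool" where
  "interleaved n \<epsilon> M N \<longleftrightarrow>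
     (\<exists>f g. pmod_hom n M (shift n \<epsilon> N) f \<and> pmod_hom n N (shift n \<epsilon> M) g \<and>
        (\<forall>r\<in>Rn n. \<forall>x\<in>obj M r. g (r + diag n \<epsilon>) (f r x) = str M r (r + diag n (2 * \<epsilon>)) x) \<and>
        (\<forall>r\<in>Rn n. \<forall>y\<in>obj N r. f (r + diag n \<epsilon>) (g r y) = str N r (r + diag n (2 * \<epsilon>)) y))"

definition interleaving_distance :: "nat \<Rightarrow> 'k::field pmod \<Rightarrow> 'k pmod \<Rightarrow> ennreal" where
  "interleaving_distance n M N = Inf {ennreal \<epsilon> | \<epsilon>. \<epsilon> \<ge> 0 \<and> interleaved n \<epsilon> M N}"


section \<open>Free modules and finitely presentable modules\<close>

text \<open>
  The value at \<open>r\<close> of the module that is \<open>'k\<close> on \<open>{j. j \<ge> i}\<close>, with identity structure maps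
  there, and \<open>0\<close> elsewhere.
\<close>

definition F_val :: "real vec \<Rightarrow> real vec \<Rightarrow> 'k::field set" where
  "F_val i r = (if i \<le> r then UNIV else {0})"

text \<open>
  The direct sum of the modules \<open>F\<close> at the entries of the list \<open>is\<close>: at \<open>r\<close> it consists of the
  tuples \<open>(v 0, \<dots>, v (length is - 1))\<close>, padded by zeros, whose \<open>m\<close>-th entry lies in
  \<open>F_val (is ! m) r\<close>. Since each summand only grows along \<open>r \<le> s\<close>, by a map that is the identity
  on \<open>'k\<close> or starts at \<open>0\<close>, the structure maps of the sum are inclusions.
\<close>

definition free_sum :: "real vec list \<Rightarrow> 'k::field pmod" where
  "free_sum is =
     \<lparr>obj = (\<lambda>r. {v. (\<forall>m < length is. v m \<in> F_val (is ! m) r) \<and> (\<forall>m \<ge> length is. v m = 0)}),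
      str = (\<lambda>r s v. v)\<rparr>"

definition free_with_barcode :: "nat \<Rightarrow> 'k::field pmod \<Rightarrow> real vec multiset \<Rightarrow> bool" where
  "free_with_barcode n P B \<longleftrightarrow>
     persistence_module n P \<and> set_mset B \<subseteq> Rn n \<and>
     (\<exists>is. mset is = B \<and> pmod_iso n P (free_sum is))"

definition finite_free :: "nat \<Rightarrow> 'k::field pmod \<Rightarrow> bool" where
  "finite_free n P \<longleftrightarrow> (\<exists>B. free_with_barcode n P B)"

definition barcode :: "nat \<Rightarrow> 'k::field pmod \<Rightarrow> real vec multiset" where
  "barcode n P = (THE B. free_with_barcode n P B)"

definition free_rank :: "nat \<Rightarrow> 'k::field pmod \<Rightarrow> nat" where
  "free_rank n P = size (barcode n P)"

text \<open>
  \<open>M\<close> is a cokernel of \<open>f : P\<^sub>1 \<rightarrow> P\<^sub>0\<close> when \<open>P\<^sub>1 \<rightarrow> P\<^sub>0 \<rightarrow> M \<rightarrow> 0\<close> is exact for some \<open>p : P\<^sub>0 \<rightarrow> M\<close>.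
\<close>

definition finitely_presentable :: "nat \<Rightarrow> 'k::field pmod \<Rightarrow> bool" where
  "finitely_presentable n M \<longleftrightarrow>
     persistence_module n M \<and>
     (\<exists>P1 P0 f p. finite_free n P1 \<and> finite_free n P0 \<and> pmod_hom n P1 P0 f \<and>
        pmod_epi n P0 M p \<and> exact_at n P1 f P0 p)"


section \<open>Minimal projective resolutions and Betti signed barcodes\<close>

definition projective :: "nat \<Rightarrow> 'k::field pmod \<Rightarrow> bool" where
  "projective n P \<longleftrightarrow>
     persistence_module n P \<and>
     (\<forall>A B e h. persistence_module n A \<and> persistence_module n B \<and>
        pmod_epi n A B e \<and> pmod_hom n P B h \<longrightarrow>
        (\<exists>l. pmod_hom n P A l \<and> (\<forall>r\<in>Rn n. \<forall>x\<in>obj P r. e r (l r x) = h r x)))"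

text \<open>
  The complex \<open>\<dots> \<rightarrow> P 2 \<rightarrow> P 1 \<rightarrow> P 0 \<rightarrow> M \<rightarrow> 0\<close> with \<open>d k : P (k + 1) \<rightarrow> P k\<close> and augmentation
  \<open>e : P 0 \<rightarrow> M\<close>.
\<close>

definition projective_resolution ::
  "nat \<Rightarrow> 'k::field pmod \<Rightarrow> (nat \<Rightarrow> 'k pmod) \<Rightarrow> (nat \<Rightarrow> 'k pmor) \<Rightarrow> 'k pmor \<Rightarrow> bool" where
  "projective_resolution n M P d e \<longleftrightarrow>
     (\<forall>k. projective n (P k)) \<and>
     (\<forall>k. pmod_hom n (P (Suc k)) (P k) (d k)) \<and>
     pmod_epi n (P 0) M e \<and>
     exact_at n (P 1) (d 0) (P 0) e \<and>
     (\<forall>k. exact_at n (P (Suc (Suc k))) (d (Suc k)) (P (Suc k)) (d k))"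

text \<open>
  Minimality of the rank of \<open>P k\<close> is tested against all resolutions \<open>Q\<close> whose \<open>k\<close>-th term has a
  finite rank; terms of infinite rank impose no condition.
\<close>

definition minimal_projective_resolution ::
  "nat \<Rightarrow> 'k::field pmod \<Rightarrow> (nat \<Rightarrow> 'k pmod) \<Rightarrow> (nat \<Rightarrow> 'k pmor) \<Rightarrow> 'k pmor \<Rightarrow> bool" where
  "minimal_projective_resolution n M P d e \<longleftrightarrow>
     projective_resolution n M P d e \<and>
     (\<forall>k. finite_free n (P k) \<and>
        (\<forall>Q d' e'. projective_resolution n M Q d' e' \<and> finite_free n (Q k) \<longrightarrow>
           free_rank n (P k) \<le> free_rank n (Q k)))"

type_synonym signed_barcode = "real vec multiset \<times> real vec multiset"

text \<open>
  Minimal projective resolutions of finitely presentable modules have finite length, so the index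
  sets below are finite; the restriction to nonempty barcodes only makes the sums range over
  finite sets. As these resolutions are unique up to isomorphism, the choice does not matter.
\<close>

definition betti_signed_barcode :: "nat \<Rightarrow> 'k::field pmod \<Rightarrow> signed_barcode" where
  "betti_signed_barcode n M =
     (SOME b. \<exists>P d e. minimal_projective_resolution n M P d e \<and>
        b = (\<Sum>k | even k \<and> barcode n (P k) \<noteq> {#}. barcode n (P k),
             \<Sum>k | odd k \<and> barcode n (P k) \<noteq> {#}. barcode n (P k)))"


section \<open>Dissimilarities on finite signed barcodes\<close>

definition barcodes :: "nat \<Rightarrow> real vec multiset set" where
  "barcodes n = {B. set_mset B \<subseteq> Rn n}"

definition signed_barcodes :: "nat \<Rightarrow> signed_barcode set" where
  "signed_barcodes n = barcodes n \<times> barcodes n"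

definition dissimilarity_on :: "'a set \<Rightarrow> ('a \<Rightarrow> 'a \<Rightarrow> ennreal) \<Rightarrow> bool" where
  "dissimilarity_on A d \<longleftrightarrow> (\<forall>a\<in>A. \<forall>b\<in>A. d a b = d b a) \<and> (\<forall>a\<in>A. d a a = 0)"

definition triangle_inequality_on :: "'a set \<Rightarrow> ('a \<Rightarrow> 'a \<Rightarrow> ennreal) \<Rightarrow> bool" where
  "triangle_inequality_on A d \<longleftrightarrow> (\<forall>a\<in>A. \<forall>b\<in>A. \<forall>c\<in>A. d a c \<le> d a b + d b c)"

definition balanced_dissimilarity :: "nat \<Rightarrow> (signed_barcode \<Rightarrow> signed_barcode \<Rightarrow> ennreal) \<Rightarrow> bool" where
  "balanced_dissimilarity n d \<longleftrightarrow>
     (\<forall>Bp Bm Cp Cm D. (Bp, Bm) \<in> signed_barcodes n \<longrightarrow> (Cp, Cm) \<in> signed_barcodes n \<longrightarrow>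
        D \<in> barcodes n \<longrightarrow> d (Bp, Bm + D) (Cp, Cm) = d (Bp, Bm) (Cp + D, Cm))"

text \<open>
  Stability refers to persistence modules over the fixed field, which the type of the
  dissimilarity does not mention; hence the type argument.
\<close>

definition stable_dissimilarity ::
  "'k::field itself \<Rightarrow> nat \<Rightarrow> (signed_barcode \<Rightarrow> signed_barcode \<Rightarrow> ennreal) \<Rightarrow> bool" where
  "stable_dissimilarity _ n d \<longleftrightarrow>
     (\<forall>M N :: 'k pmod. finitely_presentable n M \<longrightarrow> finitely_presentable n N \<longrightarrow>
        d (betti_signed_barcode n M) (betti_signed_barcode n N) \<le> interleaving_distance n M N)"

end

theory Submission
  imports Defs
begin

text \<open>
  A long bar can be cut into many short ones. The interleaving distance does not add up over direct
  sums, whereas a balanced dissimilarity that satisfies the triangle inequality glues the pieces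
  together again. Concretely, a direct sum of bars of length at most \<open>2 * \<delta>\<close> is within distance
  \<open>\<delta>\<close> of the zero module, however many bars there are. If the bars are the consecutive pieces of a
  path \<open>i = p 0 < p 1 < \<dots> < p k = j\<close>,
  the Betti signed barcode of the sum is \<open>({p 0, \<dots>, p (k - 1)}, {p 1, \<dots>, p k})\<close>. Balancedness moves
  the negative points to the other side, and together with the triangle inequality it cancels the
  common points (\<open>cancel_common_points\<close>). So \<open>({i}, \<emptyset>)\<close> and \<open>({j}, \<emptyset>)\<close> are arbitrarily close
  (\<open>dissimilarity_comparable_points\<close>), and hence a point may be moved anywhere at no cost. Barcodes
  of equal size are therefore at distance zero (\<open>dissimilarity_equal_size\<close>), and by balancedness
  the dissimilarity of \<open>(A, A')\<close> and \<open>(C, C')\<close> vanishes whenever \<open>A + C'\<close> and \<open>C + A'\<close> have the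
  same size.

  It remains to see that this condition holds for modules at finite interleaving distance. The
  number of positive minus the number of negative points is the Euler characteristic of a minimal
  resolution, which is the dimension of the module at all points that are large enough; interleaved
  modules have the same dimension there (\<open>interleaved_rank_le\<close>).

  Both steps need a hold on Betti signed barcodes. The tool is a free resolution whose differentials
  take values in radicals. Comparison of resolutions shows that its terms are retracts, modulo
  radicals, of the terms of any other projective resolution; so it is minimal, and every minimal
  resolution has the same barcodes (\<open>betti_signed_barcode_eq\<close>). For sums of bars such a resolution
  is explicit. For a finitely presentable module it is built from minimal free covers of iterated
  kernels (\<open>radical_resolution_exists\<close>): all modules that occur only change along a fixed finite set
  of points, so all generators lie in the finite set of joins of these points. Since generators
  strictly descend along the differentials, the resolution has finite length
  (\<open>radical_resolution_finite_length\<close>).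
\<close>

section \<open>Linear algebra\<close>

lemma linear_map_zero:
  assumes "linear_map V W f" "kvs.subspace V"
  shows "f 0 = 0"
proof -
  have "0 \<in> V" using assms(2) by (simp add: kvs.subspace_0)
  then have "f (0 + 0) = f 0 + f 0" using assms(1) unfolding linear_map_def by blast
  then show ?thesis by simp
qed

lemma linear_map_in: "linear_map V W f \<Longrightarrow> x \<in> V \<Longrightarrow> f x \<in> W"
  and linear_map_add: "linear_map V W f \<Longrightarrow> x \<in> V \<Longrightarrow> y \<in> V \<Longrightarrow> f (x + y) = f x + f y"
  and linear_map_scale: "linear_map V W f \<Longrightarrow> x \<in> V \<Longrightarrow> f (vscale c x) = vscale c (f x)"
  unfolding linear_map_def by blast+

lemma linear_map_diff:
  assumes "linear_map V W f" "kvs.subspace V" "x \<in> V" "y \<in> V"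
  shows "f (x - y) = f x - f y"
proof -
  have "x - y \<in> V" using assms kvs.subspace_diff by blast
  then have "f ((x - y) + y) = f (x - y) + f y" using assms linear_map_add by blast
  then show ?thesis by simp
qed

lemma linear_map_sum:
  assumes f: "linear_map V W f" and V: "kvs.subspace V" and x: "\<And>i. i \<in> I \<Longrightarrow> x i \<in> V"
  shows "f (\<Sum>i\<in>I. vscale (c i) (x i)) = (\<Sum>i\<in>I. vscale (c i) (f (x i)))"
  using x
proof (induction I rule: infinite_finite_induct)
  case (insert i I)
  have "(\<Sum>i\<in>I. vscale (c i) (x i)) \<in> V"
    using insert.prems by (intro kvs.subspace_sum[OF V] kvs.subspace_scale[OF V]) auto
  moreover have "vscale (c i) (x i) \<in> V" "x i \<in> V"
    using insert.prems kvs.subspace_scale[OF V] by auto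
  ultimately show ?case
    using insert by (simp add: linear_map_add[OF f] linear_map_scale[OF f] del: plus_fun_apply)
qed (use linear_map_zero[OF f V] in auto)

lemma linear_map_comp:
  "linear_map U V f \<Longrightarrow> linear_map V W g \<Longrightarrow> linear_map U W (\<lambda>x. g (f x))"
  unfolding linear_map_def by simp

lemma linear_map_minus:
  assumes "linear_map V W f" "linear_map V W g" "kvs.subspace W"
  shows "linear_map V W (\<lambda>x. f x - g x)"
  using assms unfolding linear_map_def
  by (auto simp: kvs.subspace_diff kvs.scale_right_diff_distrib)

lemma subspace_image:
  assumes f: "linear_map V W f" and V: "kvs.subspace V"
  shows "kvs.subspace (f ` V)"
proof (rule kvs.subspaceI)
  show "0 \<in> f ` V" using linear_map_zero[OF f V] kvs.subspace_0[OF V] by force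
next
  fix x y assume "x \<in> f ` V" "y \<in> f ` V"
  then obtain a b where "a \<in> V" "b \<in> V" "x = f a" "y = f b" by blast
  then have "x + y = f (a + b)" "a + b \<in> V"
    using linear_map_add[OF f] kvs.subspace_add[OF V] by auto
  then show "x + y \<in> f ` V" by blast
next
  fix c x assume "x \<in> f ` V"
  then obtain a where "a \<in> V" "x = f a" by blast
  then have "vscale c x = f (vscale c a)" "vscale c a \<in> V"
    using linear_map_scale[OF f] kvs.subspace_scale[OF V] by auto
  then show "vscale c x \<in> f ` V" by blast
qed

lemma subspace_kernel:
  assumes f: "linear_map V W f" and V: "kvs.subspace V"
  shows "kvs.subspace {x \<in> V. f x = 0}"
  using linear_map_zero[OF f V] linear_map_add[OF f] linear_map_scale[OF f] V
  by (intro kvs.subspaceI) (auto simp: kvs.subspace_0 kvs.subspace_add kvs.subspace_scale)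

lemma subspace_preimage:
  assumes f: "linear_map V W f" and V: "kvs.subspace V" and U: "kvs.subspace U"
  shows "kvs.subspace {x \<in> V. f x \<in> U}"
  using linear_map_zero[OF f V] linear_map_add[OF f] linear_map_scale[OF f] V U
  by (intro kvs.subspaceI) (auto simp: kvs.subspace_0 kvs.subspace_add kvs.subspace_scale)

lemma fd_space_subspace: "fd_space V \<Longrightarrow> kvs.subspace V"
  unfolding fd_space_def by blast

lemma fd_space_mono:
  assumes V: "fd_space V" and U: "kvs.subspace U" "U \<subseteq> V"
  shows "fd_space U"
proof -
  obtain T where T: "finite T" "kvs.span T = V" using V unfolding fd_space_def by blast
  obtain B where B: "B \<subseteq> U" "kvs.independent B" "U \<subseteq> kvs.span B" "card B = kvs.dim U"
    by (rule kvs.basis_exists)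
  have "B \<subseteq> kvs.span T" using B(1) U(2) T(2) by simp
  then have "finite B" using kvs.independent_span_bound[OF T(1) B(2)] by simp
  moreover have "kvs.span B = U" using B(3) kvs.span_minimal[OF B(1) U(1)] by (rule equalityI[rotated])
  ultimately show ?thesis using U(1) unfolding fd_space_def by blast
qed

text \<open>
  The set \<open>B\<close> represents a basis of the quotient \<open>V / U\<close>. This form serves both for counting
  dimensions and for choosing minimal sets of generators, where \<open>U\<close> is a radical.
\<close>

lemma basis_modulo_subspace:
  assumes V: "fd_space V" and U: "kvs.subspace U" "U \<subseteq> V"
  obtains B where "finite B" "B \<subseteq> V" "V = kvs.span (U \<union> B)"
    "\<And>c b. (\<Sum>b\<in>B. vscale (c b) b) \<in> U \<Longrightarrow> b \<in> B \<Longrightarrow> c b = 0"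
    "kvs.dim V = kvs.dim U + card B"
proof -
  have sV: "kvs.subspace V" using V by (rule fd_space_subspace)
  obtain T where T: "finite T" "kvs.span T = V" using V unfolding fd_space_def by blast
  obtain A where A: "A \<subseteq> U" "kvs.independent A" "U \<subseteq> kvs.span A" "card A = kvs.dim U"
    by (rule kvs.basis_exists)
  obtain C where C: "A \<subseteq> C" "C \<subseteq> V" "kvs.independent C" "V \<subseteq> kvs.span C"
    using A(1) U(2) by (rule kvs.maximal_independent_subset_extend[OF subset_trans A(2)])
  have "C \<subseteq> kvs.span T" using C(2) T(2) by simp
  then have finC: "finite C" using kvs.independent_span_bound[OF T(1) C(3)] by simp
  then have finA: "finite A" using C(1) finite_subset by blast
  have dimV: "card C = kvs.dim V" using C(2-4) by (intro kvs.basis_card_eq_dim)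
  define B where "B = C - A"
  have "finite B" "B \<subseteq> V" unfolding B_def using finC C(2) by auto
  moreover have "V = kvs.span (U \<union> B)"
  proof
    have "C \<subseteq> U \<union> B" unfolding B_def using A(1) by blast
    then show "V \<subseteq> kvs.span (U \<union> B)" using C(4) kvs.span_mono by blast
    show "kvs.span (U \<union> B) \<subseteq> V"
      using U(2) \<open>B \<subseteq> V\<close> by (intro kvs.span_minimal sV) auto
  qed
  moreover have "c b = 0" if cU: "(\<Sum>b\<in>B. vscale (c b) b) \<in> U" and b: "b \<in> B" for c b
  proof -
    obtain a where a: "(\<Sum>b\<in>B. vscale (c b) b) = (\<Sum>x\<in>A. vscale (a x) x)"
      using cU A(3) kvs.span_finite[OF finA] by auto
    define u where "u x = (if x \<in> A then - a x else c x)" for x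
    have "(\<Sum>x\<in>C. vscale (u x) x) = (\<Sum>x\<in>A. vscale (u x) x) + (\<Sum>x\<in>B. vscale (u x) x)"
      unfolding B_def using sum.subset_diff[OF C(1) finC] by (simp add: add.commute)
    also have "(\<Sum>x\<in>A. vscale (u x) x) = - (\<Sum>x\<in>A. vscale (a x) x)"
      by (simp add: u_def sum_negf)
    also have "(\<Sum>x\<in>B. vscale (u x) x) = (\<Sum>x\<in>B. vscale (c x) x)"
      by (rule sum.cong) (auto simp: u_def B_def)
    finally have "(\<Sum>x\<in>C. vscale (u x) x) = 0" by (simp only: a left_minus)
    then have "u b = 0" using kvs.independentD[OF C(3) finC] b unfolding B_def by blast
    then show "c b = 0" using b by (simp add: u_def B_def)
  qed
  moreover have "kvs.dim V = kvs.dim U + card B"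
    unfolding B_def using A(4) dimV C(1) finA finC card_mono[OF finC C(1)]
    by (simp add: card_Diff_subset)
  ultimately show thesis using that by blast
qed

lemma rank_nullity:
  assumes f: "linear_map V W f" and V: "fd_space V"
  shows "kvs.dim V = kvs.dim (f ` V) + kvs.dim {x \<in> V. f x = 0}"
proof -
  have sV: "kvs.subspace V" using V by (rule fd_space_subspace)
  let ?U = "{x \<in> V. f x = 0}"
  obtain B where B: "finite B" "B \<subseteq> V" "V = kvs.span (?U \<union> B)"
    and ind: "\<And>c b. (\<Sum>b\<in>B. vscale (c b) b) \<in> ?U \<Longrightarrow> b \<in> B \<Longrightarrow> c b = 0"
    and dim: "kvs.dim V = kvs.dim ?U + card B"
    using basis_modulo_subspace[OF V subspace_kernel[OF f sV]] by blast
  have sumV: "(\<Sum>b\<in>B. vscale (c b) b) \<in> V" for c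
    using B(2) by (intro kvs.subspace_sum[OF sV] kvs.subspace_scale[OF sV]) auto
  have fsum: "f (\<Sum>b\<in>B. vscale (c b) b) = (\<Sum>b\<in>B. vscale (c b) (f b))" for c
    using linear_map_sum[OF f sV, of B "\<lambda>b. b"] B(2) by auto
  have key: "c b = 0" if "(\<Sum>b\<in>B. vscale (c b) (f b)) = 0" "b \<in> B" for c b
    using ind[of c b] that fsum sumV by simp
  have inj: "inj_on f B"
  proof (rule inj_onI, rule ccontr)
    fix a b assume ab: "a \<in> B" "b \<in> B" "f a = f b" "a \<noteq> b"
    define c where "c x = (if x = a then 1 else if x = b then - 1 else 0 :: 'a)" for x
    have "(\<Sum>x\<in>B. vscale (c x) (f x)) = (\<Sum>x\<in>{a,b}. vscale (c x) (f x))"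
      using ab B(1) by (intro sum.mono_neutral_right) (auto simp: c_def)
    also have "\<dots> = 0" using ab(3,4) by (simp add: c_def)
    finally have "c a = 0" using key ab(1) by blast
    then show False by (simp add: c_def)
  qed
  have "kvs.independent (f ` B)"
  proof (rule kvs.independent_if_scalars_zero)
    show "finite (f ` B)" using B(1) by simp
    fix u y assume u: "(\<Sum>y\<in>f ` B. vscale (u y) y) = 0" and "y \<in> f ` B"
    then obtain b where "b \<in> B" "y = f b" by blast
    moreover have "(\<Sum>b\<in>B. vscale (u (f b)) (f b)) = 0"
      using u sum.reindex[OF inj, of "\<lambda>y. vscale (u y) y"] by simp
    ultimately show "u y = 0" using key[of "\<lambda>b. u (f b)"] by blast
  qed
  moreover have "f ` V \<subseteq> kvs.span (f ` B)"
  proof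
    fix y assume "y \<in> f ` V"
    then obtain x where x: "x \<in> V" "y = f x" by blast
    have "x \<in> kvs.span (?U \<union> B)" using equalityD1[OF B(3)] x(1) by (rule subsetD)
    then obtain u w where uw: "u \<in> ?U" "w \<in> kvs.span B" "x = u + w"
      unfolding kvs.span_Un kvs.span_eq_iff[THEN iffD2, OF subspace_kernel[OF f sV]]
      by auto
    obtain c where c: "w = (\<Sum>b\<in>B. vscale (c b) b)"
      using uw(2) kvs.span_finite[OF B(1)] by auto
    have "y = f w" using x uw sumV[of c] c linear_map_add[OF f, of u w] by simp
    also have "\<dots> = (\<Sum>b\<in>B. vscale (c b) (f b))" using c fsum by simp
    also have "\<dots> \<in> kvs.span (f ` B)"
      by (intro kvs.span_sum kvs.span_scale kvs.span_base) auto
    finally show "y \<in> kvs.span (f ` B)" .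
  qed
  moreover have "f ` B \<subseteq> f ` V" using B(2) by blast
  ultimately have "kvs.dim (f ` V) = card (f ` B)" using kvs.basis_card_eq_dim by metis
  then show ?thesis using dim card_image[OF inj] by simp
qed

lemma dim_le_if_injective:
  assumes f: "linear_map V W f" and V: "fd_space V" and W: "fd_space W"
    and inj: "\<And>x. x \<in> V \<Longrightarrow> f x = 0 \<Longrightarrow> x = 0"
  shows "kvs.dim V \<le> kvs.dim W"
proof -
  have sV: "kvs.subspace V" using V by (rule fd_space_subspace)
  have "f ` V \<subseteq> W" using linear_map_in[OF f] by blast
  then have "kvs.dim (f ` V) \<le> kvs.dim W"
    by (rule basis_modulo_subspace[OF W subspace_image[OF f sV]]) linarith
  moreover have "{x \<in> V. f x = 0} = {0}"
    using inj linear_map_zero[OF f sV] kvs.subspace_0[OF sV] by auto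
  moreover have "kvs.dim {0 :: nat \<Rightarrow> 'a} = 0"
    using kvs.dim_unique[of "{}" "{0}"] by (simp add: kvs.independent_empty)
  ultimately show ?thesis using rank_nullity[OF f V] by simp
qed

subsection \<open>Coordinate subspaces\<close>

definition coord_space :: "nat set \<Rightarrow> (nat \<Rightarrow> 'k::field) set" where
  "coord_space S = {v. \<forall>m. m \<notin> S \<longrightarrow> v m = 0}"

definition unit_at :: "nat \<Rightarrow> nat \<Rightarrow> 'k::field" where
  "unit_at m = (\<lambda>i. if i = m then 1 else 0)"

lemma unit_at_inj: "unit_at m = (unit_at m' :: nat \<Rightarrow> 'k::field) \<longleftrightarrow> m = m'"
  by (metis unit_at_def zero_neq_one)

lemma unit_at_in_coord_space: "m \<in> S \<Longrightarrow> unit_at m \<in> coord_space S"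
  unfolding unit_at_def coord_space_def by auto

lemma sum_fun_apply: "(\<Sum>i\<in>I. f i) x = (\<Sum>i\<in>I. f i x)"
  for f :: "'i \<Rightarrow> 'a \<Rightarrow> 'b::comm_monoid_add"
  by (induction I rule: infinite_finite_induct) auto

lemma sum_units:
  assumes "finite S"
  shows "(\<Sum>m\<in>S. vscale (c m) (unit_at m)) = (\<lambda>m. if m \<in> S then c m else 0)"
  using assms by (auto simp: fun_eq_iff sum_fun_apply vscale_def unit_at_def if_distrib cong: if_cong)

lemma coord_space_expand:
  assumes "finite S" "v \<in> coord_space S"
  shows "v = (\<Sum>m\<in>S. vscale (v m) (unit_at m))"
  using assms by (auto simp: sum_units coord_space_def fun_eq_iff)

lemma subspace_coord_space: "kvs.subspace (coord_space S)"
  unfolding coord_space_def by (intro kvs.subspaceI) (auto simp: vscale_def)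

lemma coord_space_basis:
  assumes "finite S"
  shows "kvs.span (unit_at ` S) = (coord_space S :: (nat \<Rightarrow> 'k::field) set)"
    and "kvs.independent (unit_at ` S :: (nat \<Rightarrow> 'k) set)"
proof -
  have inj: "inj_on (unit_at :: nat \<Rightarrow> nat \<Rightarrow> 'k) S" by (auto intro: inj_onI simp: unit_at_inj)
  show "kvs.span (unit_at ` S) = (coord_space S :: (nat \<Rightarrow> 'k) set)"
  proof
    show "kvs.span (unit_at ` S) \<subseteq> (coord_space S :: (nat \<Rightarrow> 'k) set)"
      using unit_at_in_coord_space by (intro kvs.span_minimal subspace_coord_space) auto
    show "coord_space S \<subseteq> kvs.span (unit_at ` S :: (nat \<Rightarrow> 'k) set)"
    proof
      fix v :: "nat \<Rightarrow> 'k" assume "v \<in> coord_space S"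
      then have "v = (\<Sum>m\<in>S. vscale (v m) (unit_at m))" using coord_space_expand assms by blast
      also have "\<dots> \<in> kvs.span (unit_at ` S)"
        by (intro kvs.span_sum kvs.span_scale kvs.span_base) auto
      finally show "v \<in> kvs.span (unit_at ` S)" .
    qed
  qed
  show "kvs.independent (unit_at ` S :: (nat \<Rightarrow> 'k) set)"
  proof (rule kvs.independent_if_scalars_zero)
    fix u :: "(nat \<Rightarrow> 'k) \<Rightarrow> 'k" and y :: "nat \<Rightarrow> 'k"
    assume u: "(\<Sum>y\<in>unit_at ` S. vscale (u y) y) = 0" and "y \<in> unit_at ` S"
    then obtain m where m: "m \<in> S" "y = unit_at m" by blast
    have "(\<Sum>m\<in>S. vscale (u (unit_at m)) (unit_at m)) = 0"
      using u sum.reindex[OF inj, of "\<lambda>y. vscale (u y) y"] by simp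
    then have "(\<lambda>m. if m \<in> S then u (unit_at m) else 0) = 0"
      using sum_units[OF assms, of "\<lambda>m. u (unit_at m)"] by simp
    from fun_cong[OF this, of m] show "u y = 0" using m by simp
  qed (use assms in simp)
qed

lemma fd_coord_space: "finite S \<Longrightarrow> fd_space (coord_space S)"
  unfolding fd_space_def using coord_space_basis subspace_coord_space by blast

lemma dim_coord_space:
  assumes "finite S"
  shows "kvs.dim (coord_space S :: (nat \<Rightarrow> 'k::field) set) = card S"
proof -
  have "inj_on (unit_at :: nat \<Rightarrow> nat \<Rightarrow> 'k) S" by (auto intro: inj_onI simp: unit_at_inj)
  then show ?thesis
    using coord_space_basis[OF assms] kvs.dim_span_eq_card_independent card_image
    by metis
qed

section \<open>Persistence modules, free modules and radicals\<close>

lemma pm_fd: "persistence_module n M \<Longrightarrow> r \<in> Rn n \<Longrightarrow> fd_space (obj M r)"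
  and pm_str: "persistence_module n M \<Longrightarrow> r \<in> Rn n \<Longrightarrow> s \<in> Rn n \<Longrightarrow> r \<le> s \<Longrightarrow>
    linear_map (obj M r) (obj M s) (str M r s)"
  and pm_id: "persistence_module n M \<Longrightarrow> r \<in> Rn n \<Longrightarrow> x \<in> obj M r \<Longrightarrow> str M r r x = x"
  and pm_comp: "persistence_module n M \<Longrightarrow> r \<in> Rn n \<Longrightarrow> s \<in> Rn n \<Longrightarrow> t \<in> Rn n \<Longrightarrow>
    r \<le> s \<Longrightarrow> s \<le> t \<Longrightarrow> x \<in> obj M r \<Longrightarrow> str M s t (str M r s x) = str M r t x"
  by (simp_all add: persistence_module_def)

lemma pm_subspace: "persistence_module n M \<Longrightarrow> r \<in> Rn n \<Longrightarrow> kvs.subspace (obj M r)"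
  using pm_fd fd_space_subspace by blast

lemma pm_str_in: "persistence_module n M \<Longrightarrow> r \<in> Rn n \<Longrightarrow> s \<in> Rn n \<Longrightarrow> r \<le> s \<Longrightarrow>
    x \<in> obj M r \<Longrightarrow> str M r s x \<in> obj M s"
  using pm_str linear_map_in by blast

lemma hom_lin: "pmod_hom n M N f \<Longrightarrow> r \<in> Rn n \<Longrightarrow> linear_map (obj M r) (obj N r) (f r)"
  and hom_nat: "pmod_hom n M N f \<Longrightarrow> r \<in> Rn n \<Longrightarrow> s \<in> Rn n \<Longrightarrow> r \<le> s \<Longrightarrow> x \<in> obj M r \<Longrightarrow>
    f s (str M r s x) = str N r s (f r x)"
  by (simp_all add: pmod_hom_def)

lemma hom_in: "pmod_hom n M N f \<Longrightarrow> r \<in> Rn n \<Longrightarrow> x \<in> obj M r \<Longrightarrow> f r x \<in> obj N r"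
  using hom_lin linear_map_in by blast

lemma hom_zero:
  "pmod_hom n M N f \<Longrightarrow> persistence_module n M \<Longrightarrow> r \<in> Rn n \<Longrightarrow> f r 0 = 0"
  using linear_map_zero[OF hom_lin pm_subspace] by blast

lemma hom_diff:
  "pmod_hom n M N f \<Longrightarrow> persistence_module n M \<Longrightarrow> r \<in> Rn n \<Longrightarrow> x \<in> obj M r \<Longrightarrow> y \<in> obj M r \<Longrightarrow>
    f r (x - y) = f r x - f r y"
  using linear_map_diff[OF hom_lin pm_subspace] by blast

lemma hom_comp:
  assumes "pmod_hom n L M f" "pmod_hom n M N g"
  shows "pmod_hom n L N (\<lambda>r x. g r (f r x))"
  using assms hom_in[OF assms(1)] unfolding pmod_hom_def
  by (auto intro: linear_map_comp)

lemma hom_id: "pmod_hom n M M (\<lambda>r x. x)"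
  if "persistence_module n M"
  using pm_str_in[OF that] unfolding pmod_hom_def linear_map_def by auto

lemma hom_minus:
  assumes "pmod_hom n M N f" "pmod_hom n M N g" "persistence_module n N"
  shows "pmod_hom n M N (\<lambda>r x. f r x - g r x)"
  unfolding pmod_hom_def
proof (intro conjI ballI impI)
  fix r assume "r \<in> Rn n"
  then show "linear_map (obj M r) (obj N r) (\<lambda>x. f r x - g r x)"
    using linear_map_minus[OF hom_lin hom_lin pm_subspace] assms by blast
next
  fix r s x assume rs: "r \<in> Rn n" "s \<in> Rn n" "r \<le> s" "x \<in> obj M r"
  have "f r x \<in> obj N r" "g r x \<in> obj N r"
    using hom_in[OF assms(1)] hom_in[OF assms(2)] rs by blast+
  then have "str N r s (f r x - g r x) = str N r s (f r x) - str N r s (g r x)"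
    by (rule linear_map_diff[OF pm_str[OF assms(3) rs(1-3)] pm_subspace[OF assms(3) rs(1)]])
  then show "f s (str M r s x) - g s (str M r s x) = str N r s (f r x - g r x)"
    using hom_nat[OF assms(1) rs] hom_nat[OF assms(2) rs] by simp
qed

definition submodule :: "'k::field pmod \<Rightarrow> (real vec \<Rightarrow> (nat \<Rightarrow> 'k) set) \<Rightarrow> 'k pmod" where
  "submodule M U = \<lparr>obj = U, str = str M\<rparr>"

lemma submodule_simps [simp]: "obj (submodule M U) = U" "str (submodule M U) = str M"
  unfolding submodule_def by simp_all

lemma pm_submodule:
  assumes M: "persistence_module n M"
    and U: "\<And>r. r \<in> Rn n \<Longrightarrow> kvs.subspace (U r)" "\<And>r. r \<in> Rn n \<Longrightarrow> U r \<subseteq> obj M r"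
    and str: "\<And>r s x. r \<in> Rn n \<Longrightarrow> s \<in> Rn n \<Longrightarrow> r \<le> s \<Longrightarrow> x \<in> U r \<Longrightarrow> str M r s x \<in> U s"
  shows "persistence_module n (submodule M U)"
  unfolding persistence_module_def submodule_simps
proof (intro conjI ballI impI)
  fix r assume "r \<in> Rn n"
  then show "fd_space (U r)" using fd_space_mono[OF pm_fd[OF M]] U by blast
next
  fix r s assume rs: "r \<in> Rn n" "s \<in> Rn n" "r \<le> s"
  then show "linear_map (U r) (U s) (str M r s)"
    using pm_str[OF M rs] str[OF rs] U(2)[of r] unfolding linear_map_def by blast
next
  fix r x assume "r \<in> Rn n" "x \<in> U r"
  then show "str M r r x = x" using pm_id[OF M] U(2) by blast
next
  fix r s t x assume "r \<in> Rn n" "s \<in> Rn n" "t \<in> Rn n" "r \<le> s" "s \<le> t" "x \<in> U r"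
  then show "str M s t (str M r s x) = str M r t x" using pm_comp[OF M] U(2) by blast
qed

lemma hom_image_subspace:
  "pmod_hom n M N f \<Longrightarrow> persistence_module n M \<Longrightarrow> r \<in> Rn n \<Longrightarrow> kvs.subspace (f r ` obj M r)"
  using subspace_image[OF hom_lin pm_subspace] by blast

subsection \<open>Free modules\<close>

abbreviation below :: "real vec list \<Rightarrow> real vec \<Rightarrow> nat set" where
  "below xs r \<equiv> {m. m < length xs \<and> xs ! m \<le> r}"

lemma obj_free_sum: "obj (free_sum xs) r = coord_space (below xs r)"
  unfolding free_sum_def coord_space_def F_val_def
  by (auto split: if_splits)

lemma str_free_sum [simp]: "str (free_sum xs) r s = (\<lambda>v. v)"
  unfolding free_sum_def by simp

lemma free_sum_mono: "r \<le> s \<Longrightarrow> obj (free_sum xs) r \<subseteq> obj (free_sum xs) s"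
  unfolding obj_free_sum coord_space_def by (auto intro: order_trans)

lemma pm_free_sum: "persistence_module n (free_sum xs)"
  unfolding persistence_module_def
proof (intro conjI ballI impI)
  fix r s :: "real vec" assume "r \<le> s"
  then show "linear_map (obj (free_sum xs) r) (obj (free_sum xs) s) (str (free_sum xs) r s)"
    using free_sum_mono[of r s xs] unfolding linear_map_def by auto
qed (auto simp: obj_free_sum fd_coord_space)

lemma unit_at_in_free_sum: "m < length xs \<Longrightarrow> xs ! m \<le> r \<Longrightarrow> unit_at m \<in> obj (free_sum xs) r"
  unfolding obj_free_sum by (simp add: unit_at_in_coord_space)

text \<open>The morphism from a free module that sends the \<open>m\<close>-th generator to \<open>a m\<close>.\<close>

definition free_hom :: "real vec list \<Rightarrow> 'k::field pmod \<Rightarrow> (nat \<Rightarrow> nat \<Rightarrow> 'k) \<Rightarrow> 'k pmor" where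
  "free_hom xs M a = (\<lambda>r v. \<Sum>m\<in>below xs r. vscale (v m) (str M (xs ! m) r (a m)))"

lemma free_hom_hom:
  fixes M :: "'k::field pmod"
  assumes M: "persistence_module n M" and xs: "set xs \<subseteq> Rn n"
    and a: "\<And>m. m < length xs \<Longrightarrow> a m \<in> obj M (xs ! m)"
  shows "pmod_hom n (free_sum xs) M (free_hom xs M a)"
  unfolding pmod_hom_def
proof (intro conjI ballI impI)
  have xs': "xs ! m \<in> Rn n" if "m < length xs" for m using that xs by auto
  have in_M: "str M (xs ! m) r (a m) \<in> obj M r" if "r \<in> Rn n" "m \<in> below xs r" for r m
    using pm_str_in[OF M xs' that(1)] a that by auto
  fix r assume r: "r \<in> Rn n"
  show "linear_map (obj (free_sum xs) r) (obj M r) (free_hom xs M a r)"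
    unfolding linear_map_def
  proof (intro conjI allI ballI)
    fix v :: "nat \<Rightarrow> 'k"
    show "free_hom xs M a r v \<in> obj M r"
      unfolding free_hom_def using in_M[OF r] pm_subspace[OF M r]
      by (intro kvs.subspace_sum kvs.subspace_scale) auto
    fix w
    show "free_hom xs M a r (v + w) = free_hom xs M a r v + free_hom xs M a r w"
      unfolding free_hom_def
      by (simp only: plus_fun_apply kvs.scale_left_distrib sum.distrib)
    fix c
    show "free_hom xs M a r (vscale c v) = vscale c (free_hom xs M a r v)"
      unfolding free_hom_def kvs.scale_sum_right
      by (rule sum.cong) (simp_all add: vscale_def mult.assoc)
  qed
  fix s and v :: "nat \<Rightarrow> 'k"
  assume s: "s \<in> Rn n" and rs: "r \<le> s" and v: "v \<in> obj (free_sum xs) r"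
  have "free_hom xs M a s v = (\<Sum>m\<in>below xs r. vscale (v m) (str M (xs ! m) s (a m)))"
    unfolding free_hom_def
  proof (rule sum.mono_neutral_right)
    show "below xs r \<subseteq> below xs s" using rs by (auto intro: order_trans)
    show "\<forall>m\<in>below xs s - below xs r. vscale (v m) (str M (xs ! m) s (a m)) = 0"
      using v unfolding obj_free_sum coord_space_def by (simp add: vscale_def zero_fun_def)
  qed simp
  also have "\<dots> = (\<Sum>m\<in>below xs r. vscale (v m) (str M r s (str M (xs ! m) r (a m))))"
    using pm_comp[OF M xs' r s _ rs a] by (intro sum.cong) auto
  also have "\<dots> = str M r s (free_hom xs M a r v)"
    unfolding free_hom_def
    by (rule linear_map_sum[OF pm_str[OF M r s rs] pm_subspace[OF M r], symmetric])
      (rule in_M[OF r])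
  finally show "free_hom xs M a s (str (free_sum xs) r s v) = str M r s (free_hom xs M a r v)"
    by simp
qed

lemma free_hom_unit_at:
  assumes "m < length xs" "xs ! m \<le> r"
  shows "free_hom xs M a r (unit_at m) = str M (xs ! m) r (a m)"
proof -
  have "free_hom xs M a r (unit_at m) = (\<Sum>i\<in>{m}. vscale (unit_at m i) (str M (xs ! i) r (a i)))"
    unfolding free_hom_def using assms
    by (intro sum.mono_neutral_right) (auto simp: unit_at_def)
  then show ?thesis by (simp add: unit_at_def)
qed

lemma hom_eq_free_hom:
  assumes f: "pmod_hom n (free_sum xs) M f" and xs: "set xs \<subseteq> Rn n"
    and r: "r \<in> Rn n" and v: "v \<in> obj (free_sum xs) r"
  shows "f r v = free_hom xs M (\<lambda>m. f (xs ! m) (unit_at m)) r v"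
proof -
  have "v = (\<Sum>m\<in>below xs r. vscale (v m) (unit_at m))"
    using coord_space_expand[of "below xs r" v] v unfolding obj_free_sum by simp
  then have "f r v = f r (\<Sum>m\<in>below xs r. vscale (v m) (unit_at m))" by (rule arg_cong)
  also have "\<dots> = (\<Sum>m\<in>below xs r. vscale (v m) (f r (unit_at m)))"
    by (rule linear_map_sum[OF hom_lin[OF f r] pm_subspace[OF pm_free_sum r]])
      (auto intro: unit_at_in_free_sum)
  also have "\<dots> = (\<Sum>m\<in>below xs r. vscale (v m) (str M (xs ! m) r (f (xs ! m) (unit_at m))))"
  proof (rule sum.cong)
    fix m assume "m \<in> below xs r"
    then have m: "m < length xs" "xs ! m \<le> r" "xs ! m \<in> Rn n" using xs by auto
    show "vscale (v m) (f r (unit_at m)) = vscale (v m) (str M (xs ! m) r (f (xs ! m) (unit_at m)))"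
      using hom_nat[OF f m(3) r m(2) unit_at_in_free_sum[OF m(1) order_refl]] by simp
  qed simp
  finally show ?thesis unfolding free_hom_def .
qed

lemma hom_free_eqI:
  assumes "pmod_hom n (free_sum xs) M f" "pmod_hom n (free_sum xs) M g" "set xs \<subseteq> Rn n"
    and "\<And>m. m < length xs \<Longrightarrow> f (xs ! m) (unit_at m) = g (xs ! m) (unit_at m)"
    and "r \<in> Rn n" "v \<in> obj (free_sum xs) r"
  shows "f r v = g r v"
proof -
  have "f r v = free_hom xs M (\<lambda>m. f (xs ! m) (unit_at m)) r v"
    "g r v = free_hom xs M (\<lambda>m. g (xs ! m) (unit_at m)) r v"
    using hom_eq_free_hom assms by blast+
  then show ?thesis using assms(4) unfolding free_hom_def by simp
qed

lemma projective_free_sum: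
  assumes xs: "set xs \<subseteq> Rn n"
  shows "projective n (free_sum xs :: 'k::field pmod)"
  unfolding projective_def
proof (intro conjI allI impI)
  show "persistence_module n (free_sum xs :: 'k pmod)" by (rule pm_free_sum)
  fix A B :: "'k pmod" and e h
  assume *: "persistence_module n A \<and> persistence_module n B \<and> pmod_epi n A B e \<and>
    pmod_hom n (free_sum xs) B h"
  then have A: "persistence_module n A" and B: "persistence_module n B"
    and e: "pmod_hom n A B e" and epi: "\<And>r. r \<in> Rn n \<Longrightarrow> e r ` obj A r = obj B r"
    and h: "pmod_hom n (free_sum xs) B h" unfolding pmod_epi_def by auto
  have "\<exists>y\<in>obj A (xs ! m). e (xs ! m) y = h (xs ! m) (unit_at m)" if "m < length xs" for m
  proof -
    have m: "xs ! m \<in> Rn n" using that xs by auto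
    then have "h (xs ! m) (unit_at m) \<in> e (xs ! m) ` obj A (xs ! m)"
      unfolding epi[OF m] using hom_in[OF h m unit_at_in_free_sum[OF that order_refl]] by blast
    then show ?thesis by force
  qed
  then obtain a where a: "\<And>m. m < length xs \<Longrightarrow> a m \<in> obj A (xs ! m)"
    "\<And>m. m < length xs \<Longrightarrow> e (xs ! m) (a m) = h (xs ! m) (unit_at m)"
    by metis
  let ?l = "free_hom xs A a"
  have l: "pmod_hom n (free_sum xs) A ?l" by (rule free_hom_hom[OF A xs a(1)])
  have "e r (?l r v) = h r v" if "r \<in> Rn n" "v \<in> obj (free_sum xs) r" for r v
  proof (rule hom_free_eqI[OF hom_comp[OF l e] h xs _ that])
    fix m assume m: "m < length xs"
    then have "?l (xs ! m) (unit_at m) = a m"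
      using free_hom_unit_at[OF m order_refl, of A a] pm_id[OF A _ a(1)[OF m]]
        subsetD[OF xs nth_mem[OF m]]
      by simp
    then show "e (xs ! m) (?l (xs ! m) (unit_at m)) = h (xs ! m) (unit_at m)" using a(2)[OF m] by simp
  qed
  then show "\<exists>l. pmod_hom n (free_sum xs) A l \<and>
      (\<forall>r\<in>Rn n. \<forall>x\<in>obj (free_sum xs) r. e r (l r x) = h r x)" using l by blast
qed

lemma projective_lift_exact:
  assumes P: "projective n P" and A: "persistence_module n A" and B: "persistence_module n B"
    and f: "pmod_hom n A B f" and ex: "\<And>r. r \<in> Rn n \<Longrightarrow> f r ` obj A r = {x \<in> obj B r. g r x = 0}"
    and h: "pmod_hom n P B h" and gh: "\<And>r x. r \<in> Rn n \<Longrightarrow> x \<in> obj P r \<Longrightarrow> g r (h r x) = 0"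
  obtains l where "pmod_hom n P A l" "\<And>r x. r \<in> Rn n \<Longrightarrow> x \<in> obj P r \<Longrightarrow> f r (l r x) = h r x"
proof -
  \<comment> \<open>The image of \<open>f\<close> is a module onto which \<open>f\<close> is an epimorphism and into which \<open>h\<close> factors.\<close>
  define I where "I = submodule B (\<lambda>r. f r ` obj A r)"
  have I: "persistence_module n I"
    unfolding I_def
  proof (rule pm_submodule[OF B])
    fix r s x assume rs: "r \<in> Rn n" "s \<in> Rn n" "r \<le> s" and "x \<in> f r ` obj A r"
    then obtain y where "y \<in> obj A r" "x = f r y" by blast
    then have "str B r s x = f s (str A r s y)" "str A r s y \<in> obj A s"
      using hom_nat[OF f rs] pm_str_in[OF A rs] by auto
    then show "str B r s x \<in> f s ` obj A s" by blast
  qed (use hom_image_subspace[OF f A] ex in auto)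
  have "pmod_epi n A I f"
    using f unfolding pmod_epi_def pmod_hom_def I_def linear_map_def by auto
  moreover have "pmod_hom n P I h"
    using h gh unfolding pmod_hom_def I_def linear_map_def by (auto simp: ex)
  ultimately show thesis using P A I that unfolding projective_def by blast
qed

subsection \<open>Radicals\<close>

text \<open>
  The radical at \<open>r\<close> collects what is already generated strictly below \<open>r\<close>; the number of
  generators of a free module at \<open>r\<close> is the codimension of its radical there.
\<close>

definition radical :: "nat \<Rightarrow> 'k::field pmod \<Rightarrow> real vec \<Rightarrow> (nat \<Rightarrow> 'k) set" where
  "radical n M r = kvs.span (\<Union>s\<in>{s \<in> Rn n. s \<le> r \<and> s \<noteq> r}. str M s r ` obj M s)"

lemma subspace_radical: "kvs.subspace (radical n M r)"
  unfolding radical_def by (rule kvs.subspace_span)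

lemma radical_base:
  "s \<in> Rn n \<Longrightarrow> s \<le> r \<Longrightarrow> s \<noteq> r \<Longrightarrow> x \<in> obj M s \<Longrightarrow> str M s r x \<in> radical n M r"
  unfolding radical_def by (rule kvs.span_base) blast

lemma radical_subset:
  assumes "persistence_module n M" "r \<in> Rn n"
  shows "radical n M r \<subseteq> obj M r"
  unfolding radical_def
  by (rule kvs.span_minimal) (use assms pm_str_in pm_subspace in blast)+

lemma hom_radical:
  assumes f: "pmod_hom n M N f" and M: "persistence_module n M" and r: "r \<in> Rn n"
    and x: "x \<in> radical n M r"
  shows "f r x \<in> radical n N r"
proof -
  let ?T = "{x \<in> obj M r. f r x \<in> radical n N r}"
  have "radical n M r \<subseteq> ?T"
    unfolding radical_def[of n M]
  proof (rule kvs.span_minimal)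
    show "kvs.subspace ?T"
      by (rule subspace_preimage[OF hom_lin[OF f r] pm_subspace[OF M r] subspace_radical])
    show "(\<Union>s\<in>{s \<in> Rn n. s \<le> r \<and> s \<noteq> r}. str M s r ` obj M s) \<subseteq> ?T"
      using pm_str_in[OF M _ r] by (auto simp: hom_nat[OF f _ r] intro!: radical_base hom_in[OF f])
  qed
  then show ?thesis using x by blast
qed

lemma radical_free_sum:
  assumes xs: "set xs \<subseteq> Rn n" and r: "r \<in> Rn n"
  shows "radical n (free_sum xs :: 'k::field pmod) r = coord_space {m \<in> below xs r. xs ! m \<noteq> r}"
proof
  let ?S = "{m \<in> below xs r. xs ! m \<noteq> r}"
  show "radical n (free_sum xs :: 'k pmod) r \<subseteq> coord_space ?S"
    unfolding radical_def
  proof (rule kvs.span_minimal[OF _ subspace_coord_space])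
    have "below xs s \<subseteq> ?S" if "s \<le> r" "s \<noteq> r" for s
      using that by (auto intro: order_trans order.antisym)
    then show "(\<Union>s\<in>{s \<in> Rn n. s \<le> r \<and> s \<noteq> r}. str (free_sum xs) s r ` obj (free_sum xs) s)
        \<subseteq> coord_space ?S"
      by (auto simp: obj_free_sum coord_space_def subset_iff)
  qed
  show "coord_space ?S \<subseteq> radical n (free_sum xs :: 'k pmod) r"
  proof
    fix v :: "nat \<Rightarrow> 'k" assume "v \<in> coord_space ?S"
    then have v: "v = (\<Sum>m\<in>?S. vscale (v m) (unit_at m))" by (intro coord_space_expand) auto
    have "unit_at m \<in> radical n (free_sum xs :: 'k pmod) r" if "m \<in> ?S" for m
      using radical_base[of "xs ! m" n r "unit_at m" "free_sum xs"] that subsetD[OF xs nth_mem]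
      by (simp add: unit_at_in_free_sum)
    then have "(\<Sum>m\<in>?S. vscale (v m) (unit_at m)) \<in> radical n (free_sum xs) r"
      by (intro kvs.subspace_sum kvs.subspace_scale subspace_radical)
    then show "v \<in> radical n (free_sum xs) r" using v by metis
  qed
qed

text \<open>
  The quotient of a free module by its radical at \<open>r\<close> has the generators at \<open>r\<close> as a basis. On
  these quotients \<open>g\<close> is a left inverse of \<open>f\<close>, so \<open>f\<close> is injective there and the generators can
  be counted.
\<close>

lemma barcode_subset_if_retract_modulo_radical:
  assumes xs: "set xs \<subseteq> Rn n" and ys: "set ys \<subseteq> Rn n"
    and f: "pmod_hom n (free_sum xs) (free_sum ys) f"
    and g: "pmod_hom n (free_sum ys) (free_sum xs :: 'k::field pmod) g"
    and gf: "\<And>r x. r \<in> Rn n \<Longrightarrow> x \<in> obj (free_sum xs) r \<Longrightarrow>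
      g r (f r x) - x \<in> radical n (free_sum xs) r"
  shows "mset xs \<subseteq># mset ys"
proof (rule mset_subset_eqI)
  fix r
  show "count (mset xs) r \<le> count (mset ys) r"
  proof (cases "r \<in> set xs")
    case False
    then have "count (mset xs) r = 0" by simp
    then show ?thesis by (simp only: le0)
  next
    case True
    then have r: "r \<in> Rn n" using xs by blast
    define I where "I = {m. m < length xs \<and> xs ! m = r}"
    define J where "J = {m. m < length ys \<and> ys ! m = r}"
    define \<phi> :: "(nat \<Rightarrow> 'k) \<Rightarrow> (nat \<Rightarrow> 'k)" where "\<phi> v m = (if m \<in> J then f r v m else 0)" for v m
    have Ixs: "coord_space I \<subseteq> obj (free_sum xs) r"
      unfolding I_def obj_free_sum coord_space_def by auto
    have \<phi>: "linear_map (coord_space I) (coord_space J) \<phi>"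
      using hom_lin[OF f r] Ixs unfolding linear_map_def
      by (auto simp: coord_space_def \<phi>_def fun_eq_iff vscale_def subset_iff)
    have "v = 0" if v: "v \<in> coord_space I" and v0: "\<phi> v = 0" for v
    proof -
      have vx: "v \<in> obj (free_sum xs) r" using v Ixs by blast
      have "f r v m = 0" if "m \<in> J" for m using fun_cong[OF v0, of m] that by (simp add: \<phi>_def)
      moreover have "f r v \<in> coord_space (below ys r)"
        using hom_in[OF f r vx] unfolding obj_free_sum .
      ultimately have "f r v \<in> radical n (free_sum ys) r"
        unfolding radical_free_sum[OF ys r] J_def coord_space_def by auto
      then have "g r (f r v) \<in> radical n (free_sum xs) r"
        using hom_radical[OF g pm_free_sum r] by blast
      then have "g r (f r v) - (g r (f r v) - v) \<in> radical n (free_sum xs) r"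
        using gf[OF r vx] by (rule kvs.subspace_diff[OF subspace_radical])
      moreover have "g r (f r v) - (g r (f r v) - v) = v" by (rule ext) simp
      ultimately have "v \<in> radical n (free_sum xs) r" by simp
      then show "v = 0"
        using v unfolding radical_free_sum[OF xs r] coord_space_def I_def by (auto simp: fun_eq_iff)
    qed
    then have "kvs.dim (coord_space I :: (nat \<Rightarrow> 'k) set)
        \<le> kvs.dim (coord_space J :: (nat \<Rightarrow> 'k) set)"
      by (intro dim_le_if_injective[OF \<phi> fd_coord_space fd_coord_space])
        (auto simp: I_def J_def)
    then have "card I \<le> card J" by (simp add: dim_coord_space I_def J_def)
    then show ?thesis
      unfolding I_def J_def count_mset count_list_eq_length_filter length_filter_conv_card
      by (simp add: eq_commute)
  qed
qed

lemma free_with_barcode_unique: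
  fixes P :: "'k::field pmod"
  assumes "free_with_barcode n P B" "free_with_barcode n P C"
  shows "B \<subseteq># C"
proof -
  obtain xs ys f f' g g' where xs: "mset xs = B" and ys: "mset ys = C"
    and f: "pmod_hom n P (free_sum xs) f" "pmod_hom n (free_sum xs) P f'"
    and ff: "\<And>r y. r \<in> Rn n \<Longrightarrow> y \<in> obj (free_sum xs) r \<Longrightarrow> f r (f' r y) = y"
    and g: "pmod_hom n P (free_sum ys) g" "pmod_hom n (free_sum ys) P g'"
    and gg: "\<And>r y. r \<in> Rn n \<Longrightarrow> y \<in> obj P r \<Longrightarrow> g' r (g r y) = y"
    using assms unfolding free_with_barcode_def pmod_iso_def by blast
  have "set xs \<subseteq> Rn n" "set ys \<subseteq> Rn n"
    using assms xs ys unfolding free_with_barcode_def by auto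
  then have "mset xs \<subseteq># mset ys"
  proof (rule barcode_subset_if_retract_modulo_radical[OF _ _ hom_comp[OF f(2) g(1)] hom_comp[OF g(2) f(1)]])
    fix r and x :: "nat \<Rightarrow> 'k" assume "r \<in> Rn n" "x \<in> obj (free_sum xs) r"
    then have "f r (g' r (g r (f' r x))) - x = 0" using gg hom_in[OF f(2)] ff by simp
    then show "f r (g' r (g r (f' r x))) - x \<in> radical n (free_sum xs) r"
      using kvs.subspace_0[OF subspace_radical] by simp
  qed
  then show ?thesis using xs ys by simp
qed

lemma barcode_eq:
  assumes "free_with_barcode n P B"
  shows "barcode n P = B"
  unfolding barcode_def
proof (rule the_equality)
  fix C assume "free_with_barcode n P C"
  then show "C = B" using free_with_barcode_unique assms by (blast intro: subset_mset.antisym)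
qed (rule assms)

lemma free_with_barcode_free_sum:
  assumes "set xs \<subseteq> Rn n"
  shows "free_with_barcode n (free_sum xs) (mset xs)"
  using assms pm_free_sum hom_id[OF pm_free_sum] unfolding free_with_barcode_def pmod_iso_def
  by fastforce

lemma barcode_free_sum: "set xs \<subseteq> Rn n \<Longrightarrow> barcode n (free_sum xs) = mset xs"
  by (intro barcode_eq free_with_barcode_free_sum)

lemma finite_free_free_sum: "set xs \<subseteq> Rn n \<Longrightarrow> finite_free n (free_sum xs)"
  unfolding finite_free_def using free_with_barcode_free_sum by blast

lemma finite_free_barcode: "finite_free n P \<Longrightarrow> free_with_barcode n P (barcode n P)"
  unfolding finite_free_def using barcode_eq by metis

section \<open>Comparison of resolutions\<close>

text \<open>
  Counting the augmentation among the differentials turns exactness at the first term and at all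
  later terms into one statement.
\<close>

definition outgoing :: "'k pmor \<Rightarrow> (nat \<Rightarrow> 'k pmor) \<Rightarrow> nat \<Rightarrow> 'k::field pmor" where
  "outgoing e d k = (case k of 0 \<Rightarrow> e | Suc j \<Rightarrow> d j)"

lemma outgoing_simps [simp]: "outgoing e d 0 = e" "outgoing e d (Suc k) = d k"
  unfolding outgoing_def by simp_all

context
  fixes n :: nat and M :: "'k::field pmod" and P d e
  assumes res: "projective_resolution n M P d e"
begin

lemma resolution_projective: "projective n (P k)"
  and resolution_pm: "persistence_module n (P k)"
  and resolution_hom: "pmod_hom n (P (Suc k)) (P k) (d k)"
  and resolution_epi: "pmod_epi n (P 0) M e"
  using res unfolding projective_resolution_def projective_def by auto

lemma resolution_augmentation: "pmod_hom n (P 0) M e"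
  using resolution_epi unfolding pmod_epi_def by blast

lemma resolution_exact:
  assumes "r \<in> Rn n"
  shows "d k r ` obj (P (Suc k)) r = {x \<in> obj (P k) r. outgoing e d k r x = 0}"
  using res assms unfolding projective_resolution_def exact_at_def by (cases k) auto

lemma resolution_complex:
  assumes "r \<in> Rn n" "x \<in> obj (P (Suc k)) r"
  shows "outgoing e d k r (d k r x) = 0"
  using resolution_exact[OF assms(1), of k] assms(2) by blast

end

lemma resolution_chain_map:
  fixes M :: "'k::field pmod"
  assumes M: "persistence_module n M"
    and P: "projective_resolution n M P d e" and Q: "projective_resolution n M Q d' e'"
  obtains f where "\<And>k. pmod_hom n (P k) (Q k) (f k)"
    "\<And>r x. r \<in> Rn n \<Longrightarrow> x \<in> obj (P 0) r \<Longrightarrow> e' r (f 0 r x) = e r x"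
    "\<And>k r x. r \<in> Rn n \<Longrightarrow> x \<in> obj (P (Suc k)) r \<Longrightarrow> d' k r (f (Suc k) r x) = f k r (d k r x)"
proof -
  \<comment> \<open>\<open>A\<close> is what the lift to the next term needs, and \<open>B\<close> relates consecutive choices.\<close>
  define A where "A k f \<longleftrightarrow> pmod_hom n (P k) (Q k) f \<and>
    (\<forall>r\<in>Rn n. \<forall>x\<in>obj (P (Suc k)) r. outgoing e' d' k r (f r (d k r x)) = 0) \<and>
    (k = 0 \<longrightarrow> (\<forall>r\<in>Rn n. \<forall>x\<in>obj (P 0) r. e' r (f r x) = e r x))" for k f
  define B where "B k f f' \<longleftrightarrow>
    (\<forall>r\<in>Rn n. \<forall>x\<in>obj (P (Suc k)) r. d' k r (f' r x) = f r (d k r x))" for k f f'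
  have "\<exists>f. \<forall>k. A k (f k) \<and> B k (f k) (f (Suc k))"
  proof (rule dependent_nat_choice)
    obtain f where f: "pmod_hom n (P 0) (Q 0) f"
      "\<And>r x. r \<in> Rn n \<Longrightarrow> x \<in> obj (P 0) r \<Longrightarrow> e' r (f r x) = e r x"
      using resolution_projective[OF P, of 0] resolution_pm[OF Q, of 0] resolution_epi[OF Q]
        resolution_augmentation[OF P] M unfolding projective_def by metis
    have "e' r (f r (d 0 r x)) = 0" if "r \<in> Rn n" "x \<in> obj (P (Suc 0)) r" for r x
      using f(2)[OF that(1) hom_in[OF resolution_hom[OF P] that]]
        resolution_complex[OF P that] by simp
    then show "\<exists>f. A 0 f" using f unfolding A_def by auto
  next
    fix f k assume f: "A k f"
    then have hf: "pmod_hom n (P k) (Q k) f" unfolding A_def by blast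
    have h: "pmod_hom n (P (Suc k)) (Q k) (\<lambda>r x. f r (d k r x))"
      by (rule hom_comp[OF resolution_hom[OF P] hf])
    obtain l where l: "pmod_hom n (P (Suc k)) (Q (Suc k)) l"
      "\<And>r x. r \<in> Rn n \<Longrightarrow> x \<in> obj (P (Suc k)) r \<Longrightarrow> d' k r (l r x) = f r (d k r x)"
    proof (rule projective_lift_exact[OF resolution_projective[OF P] resolution_pm[OF Q]
          resolution_pm[OF Q] resolution_hom[OF Q] resolution_exact[OF Q] h])
      fix r x assume "r \<in> Rn n" "x \<in> obj (P (Suc k)) r"
      then show "outgoing e' d' k r (f r (d k r x)) = 0" using f unfolding A_def by blast
    qed (assumption, blast)
    have "d' k r (l r (d (Suc k) r x)) = 0"
      if "r \<in> Rn n" "x \<in> obj (P (Suc (Suc k))) r" for r x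
      using l(2)[OF that(1) hom_in[OF resolution_hom[OF P] that]]
        resolution_complex[OF P that] hom_zero[OF hf resolution_pm[OF P] that(1)] by simp
    then have "A (Suc k) l" using l(1) unfolding A_def by simp
    then show "\<exists>f'. A (Suc k) f' \<and> B k f f'" using l(2) unfolding B_def by blast
  qed
  then obtain f where "\<And>k. A k (f k)" "\<And>k. B k (f k) (f (Suc k))" by blast
  then show thesis using that[of f] unfolding A_def B_def by blast
qed

text \<open>
  A chain endomorphism over the identity of \<open>M\<close> is homotopic to the identity; each homotopy
  component lifts the part of the difference that the previous one leaves over, which is a cycle.
\<close>

lemma resolution_homotopy:
  fixes M :: "'k::field pmod"
  assumes P: "projective_resolution n M P d e"
    and h: "\<And>k. pmod_hom n (P k) (P k) (h k)"
    and h0: "\<And>r x. r \<in> Rn n \<Longrightarrow> x \<in> obj (P 0) r \<Longrightarrow> e r (h 0 r x) = e r x"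
    and hd: "\<And>k r x. r \<in> Rn n \<Longrightarrow> x \<in> obj (P (Suc k)) r \<Longrightarrow> d k r (h (Suc k) r x) = h k r (d k r x)"
  obtains s where "\<And>k. pmod_hom n (P k) (P (Suc k)) (s k)"
    "\<And>r x. r \<in> Rn n \<Longrightarrow> x \<in> obj (P 0) r \<Longrightarrow> d 0 r (s 0 r x) = h 0 r x - x"
    "\<And>k r x. r \<in> Rn n \<Longrightarrow> x \<in> obj (P (Suc k)) r \<Longrightarrow>
      d (Suc k) r (s (Suc k) r x) = h (Suc k) r x - x - s k r (d k r x)"
proof -
  note pm = resolution_pm[OF P] and hom = resolution_hom[OF P]
  have minus_id: "pmod_hom n (P k) (P k) (\<lambda>r x. h k r x - x)" for k
    by (rule hom_minus[OF h hom_id[OF pm] pm])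
  have commute: "d k r (h (Suc k) r x - x) = h k r (d k r x) - d k r x"
    if "r \<in> Rn n" "x \<in> obj (P (Suc k)) r" for k r x
    using hom_diff[OF hom pm that(1) hom_in[OF h that] that(2)] hd[OF that] by simp
  define A where "A k s \<longleftrightarrow> pmod_hom n (P k) (P (Suc k)) s \<and>
    (\<forall>r\<in>Rn n. \<forall>x\<in>obj (P (Suc k)) r. d k r (h (Suc k) r x - x - s r (d k r x)) = 0) \<and>
    (k = 0 \<longrightarrow> (\<forall>r\<in>Rn n. \<forall>x\<in>obj (P 0) r. d 0 r (s r x) = h 0 r x - x))" for k s
  define B where "B k s s' \<longleftrightarrow>
    (\<forall>r\<in>Rn n. \<forall>x\<in>obj (P (Suc k)) r. d (Suc k) r (s' r x) = h (Suc k) r x - x - s r (d k r x))"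
    for k s s'
  have "\<exists>s. \<forall>k. A k (s k) \<and> B k (s k) (s (Suc k))"
  proof (rule dependent_nat_choice)
    obtain s where s: "pmod_hom n (P 0) (P (Suc 0)) s"
      "\<And>r x. r \<in> Rn n \<Longrightarrow> x \<in> obj (P 0) r \<Longrightarrow> d 0 r (s r x) = h 0 r x - x"
    proof (rule projective_lift_exact[OF resolution_projective[OF P] pm pm hom
          resolution_exact[OF P] minus_id])
      fix r x assume "r \<in> Rn n" "x \<in> obj (P 0) r"
      then show "outgoing e d 0 r (h 0 r x - x) = 0"
        using hom_diff[OF resolution_augmentation[OF P] pm _ hom_in[OF h]] h0 by simp
    qed (assumption, blast)
    have "d 0 r (h (Suc 0) r x - x - s r (d 0 r x)) = 0"
      if rx: "r \<in> Rn n" "x \<in> obj (P (Suc 0)) r" for r x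
    proof -
      have dx: "d 0 r x \<in> obj (P 0) r" by (rule hom_in[OF hom rx])
      have "d 0 r (h (Suc 0) r x - x - s r (d 0 r x))
          = d 0 r (h (Suc 0) r x - x) - d 0 r (s r (d 0 r x))"
        by (rule hom_diff[OF hom pm rx(1) hom_in[OF minus_id rx] hom_in[OF s(1) rx(1) dx]])
      then show ?thesis using commute[OF rx] s(2)[OF rx(1) dx] by simp
    qed
    then show "\<exists>s. A 0 s" using s unfolding A_def by blast
  next
    fix s k assume s: "A k s"
    then have hs: "pmod_hom n (P k) (P (Suc k)) s" unfolding A_def by blast
    have g: "pmod_hom n (P (Suc k)) (P (Suc k)) (\<lambda>r x. h (Suc k) r x - x - s r (d k r x))"
      by (rule hom_minus[OF minus_id hom_comp[OF hom hs] pm])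
    obtain l where l: "pmod_hom n (P (Suc k)) (P (Suc (Suc k))) l"
      "\<And>r x. r \<in> Rn n \<Longrightarrow> x \<in> obj (P (Suc k)) r \<Longrightarrow>
        d (Suc k) r (l r x) = h (Suc k) r x - x - s r (d k r x)"
    proof (rule projective_lift_exact[OF resolution_projective[OF P] pm pm hom
          resolution_exact[OF P] g])
      fix r x assume "r \<in> Rn n" "x \<in> obj (P (Suc k)) r"
      then show "outgoing e d (Suc k) r (h (Suc k) r x - x - s r (d k r x)) = 0"
        using s unfolding A_def by simp
    qed (assumption, blast)
    have "d (Suc k) r (h (Suc (Suc k)) r x - x - l r (d (Suc k) r x)) = 0"
      if rx: "r \<in> Rn n" "x \<in> obj (P (Suc (Suc k))) r" for r x
    proof -
      have dx: "d (Suc k) r x \<in> obj (P (Suc k)) r" by (rule hom_in[OF hom rx])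
      have "d (Suc k) r (h (Suc (Suc k)) r x - x - l r (d (Suc k) r x))
          = d (Suc k) r (h (Suc (Suc k)) r x - x) - d (Suc k) r (l r (d (Suc k) r x))"
        by (rule hom_diff[OF hom pm rx(1) hom_in[OF minus_id rx] hom_in[OF l(1) rx(1) dx]])
      moreover have "s r (d k r (d (Suc k) r x)) = 0"
        using resolution_complex[OF P rx] hom_zero[OF hs pm rx(1)] by simp
      ultimately show ?thesis using commute[OF rx] l(2)[OF rx(1) dx] by simp
    qed
    then have "A (Suc k) l" using l(1) unfolding A_def by simp
    then show "\<exists>s'. A (Suc k) s' \<and> B k s s'" using l(2) unfolding B_def by blast
  qed
  then obtain s where "\<And>k. A k (s k)" "\<And>k. B k (s k) (s (Suc k))" by blast
  then show thesis using that[of s] unfolding A_def B_def by blast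
qed

section \<open>Resolutions with radical differentials\<close>

definition radical_resolution ::
  "nat \<Rightarrow> 'k::field pmod \<Rightarrow> (nat \<Rightarrow> real vec list) \<Rightarrow> (nat \<Rightarrow> 'k pmor) \<Rightarrow> 'k pmor \<Rightarrow> bool" where
  "radical_resolution n M xs d e \<longleftrightarrow>
     (\<forall>k. set (xs k) \<subseteq> Rn n) \<and> projective_resolution n M (\<lambda>k. free_sum (xs k)) d e \<and>
     (\<forall>k. \<forall>r\<in>Rn n. d k r ` obj (free_sum (xs (Suc k))) r \<subseteq> radical n (free_sum (xs k)) r)"

text \<open>
  Comparison maps to another resolution and back compose to a map that is homotopic to the
  identity. The homotopy terms contain a differential, hence vanish modulo the radical, so that
  the free terms are retracts modulo radicals of the terms of the other resolution.
\<close>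

lemma radical_resolution_barcode_subset:
  fixes M :: "'k::field pmod"
  assumes M: "persistence_module n M" and R: "radical_resolution n M xs d e"
    and Q: "projective_resolution n M Q d' e'" and Qk: "finite_free n (Q k)"
  shows "mset (xs k) \<subseteq># barcode n (Q k)"
proof -
  let ?P = "\<lambda>k. free_sum (xs k) :: 'k pmod"
  have xs: "\<And>k. set (xs k) \<subseteq> Rn n" and P: "projective_resolution n M ?P d e"
    and rad: "\<And>k r x. r \<in> Rn n \<Longrightarrow> x \<in> obj (?P (Suc k)) r \<Longrightarrow> d k r x \<in> radical n (?P k) r"
    using R unfolding radical_resolution_def by blast+
  obtain f where f: "\<And>k. pmod_hom n (?P k) (Q k) (f k)"
    "\<And>r x. r \<in> Rn n \<Longrightarrow> x \<in> obj (?P 0) r \<Longrightarrow> e' r (f 0 r x) = e r x"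
    "\<And>k r x. r \<in> Rn n \<Longrightarrow> x \<in> obj (?P (Suc k)) r \<Longrightarrow> d' k r (f (Suc k) r x) = f k r (d k r x)"
    using resolution_chain_map[OF M P Q] by blast
  obtain g where g: "\<And>k. pmod_hom n (Q k) (?P k) (g k)"
    "\<And>r x. r \<in> Rn n \<Longrightarrow> x \<in> obj (Q 0) r \<Longrightarrow> e r (g 0 r x) = e' r x"
    "\<And>k r x. r \<in> Rn n \<Longrightarrow> x \<in> obj (Q (Suc k)) r \<Longrightarrow> d k r (g (Suc k) r x) = g k r (d' k r x)"
    using resolution_chain_map[OF M Q P] by blast
  obtain s where s: "\<And>k. pmod_hom n (?P k) (?P (Suc k)) (s k)"
    "\<And>r x. r \<in> Rn n \<Longrightarrow> x \<in> obj (?P 0) r \<Longrightarrow> d 0 r (s 0 r x) = g 0 r (f 0 r x) - x"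
    "\<And>k r x. r \<in> Rn n \<Longrightarrow> x \<in> obj (?P (Suc k)) r \<Longrightarrow>
      d (Suc k) r (s (Suc k) r x) = g (Suc k) r (f (Suc k) r x) - x - s k r (d k r x)"
  proof (rule resolution_homotopy[OF P, of "\<lambda>k r x. g k r (f k r x)"])
    show "pmod_hom n (?P k) (?P k) (\<lambda>r x. g k r (f k r x))" for k
      by (rule hom_comp[OF f(1) g(1)])
  next
    fix r x assume "r \<in> Rn n" "x \<in> obj (?P 0) r"
    then show "e r (g 0 r (f 0 r x)) = e r x" using g(2) f(2) hom_in[OF f(1)] by simp
  next
    fix k r x assume "r \<in> Rn n" "x \<in> obj (?P (Suc k)) r"
    then show "d k r (g (Suc k) r (f (Suc k) r x)) = g k r (f k r (d k r x))"
      using g(3)[of r "f (Suc k) r x" k] f(3)[of r x k] hom_in[OF f(1), of r x "Suc k"] by simp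
  qed blast
  have retract: "g k r (f k r x) - x \<in> radical n (?P k) r"
    if rx: "r \<in> Rn n" "x \<in> obj (?P k) r" for r x
  proof (cases k)
    case 0
    then show ?thesis using s(2) rad[OF rx(1) hom_in[OF s(1) rx]] rx by simp
  next
    case (Suc j)
    have "d k r (s k r x) \<in> radical n (?P k) r" by (rule rad[OF rx(1) hom_in[OF s(1) rx]])
    moreover have "s j r (d j r x) \<in> radical n (?P k) r"
      using hom_radical[OF s(1) pm_free_sum rx(1) rad[OF rx(1)], of x j] rx Suc by simp
    ultimately have "d k r (s k r x) + s j r (d j r x) \<in> radical n (?P k) r"
      by (rule kvs.subspace_add[OF subspace_radical])
    moreover have "d k r (s k r x) + s j r (d j r x) = g k r (f k r x) - x"
      using s(3)[of r x j] rx Suc by simp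
    ultimately show ?thesis by simp
  qed
  obtain ys \<phi> \<psi> where ys: "mset ys = barcode n (Q k)" "set_mset (barcode n (Q k)) \<subseteq> Rn n"
    and \<phi>: "pmod_hom n (Q k) (free_sum ys) \<phi>" and \<psi>: "pmod_hom n (free_sum ys) (Q k) \<psi>"
    and inv: "\<And>r y. r \<in> Rn n \<Longrightarrow> y \<in> obj (Q k) r \<Longrightarrow> \<psi> r (\<phi> r y) = y"
    using finite_free_barcode[OF Qk] unfolding free_with_barcode_def pmod_iso_def by blast
  have "set ys \<subseteq> Rn n" using ys by (metis set_mset_mset)
  then have "mset (xs k) \<subseteq># mset ys"
  proof (rule barcode_subset_if_retract_modulo_radical[OF xs _ hom_comp[OF f(1) \<phi>]
        hom_comp[OF \<psi> g(1)]])
    fix r x assume "r \<in> Rn n" "x \<in> obj (?P k) r"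
    then show "g k r (\<psi> r (\<phi> r (f k r x))) - x \<in> radical n (?P k) r"
      using inv hom_in[OF f(1)] retract by simp
  qed
  then show ?thesis using ys by simp
qed

lemma minimal_if_radical_resolution:
  fixes M :: "'k::field pmod"
  assumes M: "persistence_module n M" and R: "radical_resolution n M xs d e"
  shows "minimal_projective_resolution n M (\<lambda>k. free_sum (xs k)) d e"
proof -
  have xs: "\<And>k. set (xs k) \<subseteq> Rn n"
    and P: "projective_resolution n M (\<lambda>k. free_sum (xs k)) d e"
    using R unfolding radical_resolution_def by blast+
  have "free_rank n (free_sum (xs k) :: 'k pmod) \<le> free_rank n (Q k)"
    if "projective_resolution n M Q d' e' \<and> finite_free n (Q k)" for k Q d' e'
    using size_mset_mono[OF radical_resolution_barcode_subset[OF M R]] that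
    unfolding free_rank_def barcode_free_sum[OF xs] by blast
  then show ?thesis
    using P finite_free_free_sum[OF xs] unfolding minimal_projective_resolution_def by blast
qed

text \<open>One barcode contains the other, and the two have the same size by minimality.\<close>

lemma minimal_barcode_unique:
  fixes M :: "'k::field pmod"
  assumes M: "persistence_module n M" and R: "radical_resolution n M xs d e"
    and P: "minimal_projective_resolution n M P d' e'"
  shows "barcode n (P k) = mset (xs k)"
proof -
  have P': "projective_resolution n M P d' e'" "finite_free n (P k)"
    using P unfolding minimal_projective_resolution_def by auto
  have xs: "set (xs k) \<subseteq> Rn n" and R': "projective_resolution n M (\<lambda>k. free_sum (xs k)) d e"
    using R unfolding radical_resolution_def by auto
  have "free_rank n (P k) \<le> free_rank n (free_sum (xs k) :: 'k pmod)"
    using P R' finite_free_free_sum[OF xs] unfolding minimal_projective_resolution_def by blast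
  then have "size (barcode n (P k)) \<le> size (mset (xs k))"
    unfolding free_rank_def barcode_free_sum[OF xs] .
  moreover have "mset (xs k) \<subseteq># barcode n (P k)"
    by (rule radical_resolution_barcode_subset[OF M R P'])
  ultimately show ?thesis
    by (metis mset_subset_size not_less subset_mset.le_less)
qed

text \<open>
  All minimal resolutions have the barcodes of the given radical one, which is itself minimal, so
  the choice in the definition of the Betti signed barcode is immaterial.
\<close>

lemma betti_signed_barcode_eq:
  fixes M :: "'k::field pmod"
  assumes M: "persistence_module n M" and R: "radical_resolution n M xs d e"
  shows "betti_signed_barcode n M =
    (\<Sum>k | even k \<and> xs k \<noteq> []. mset (xs k), \<Sum>k | odd k \<and> xs k \<noteq> []. mset (xs k))"
  unfolding betti_signed_barcode_def
proof (rule some_equality)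
  have xs: "barcode n (free_sum (xs k) :: 'k pmod) = mset (xs k)" for k
    by (rule barcode_free_sum) (use R in \<open>simp add: radical_resolution_def\<close>)
  show "\<exists>P d e. minimal_projective_resolution n M P d e \<and>
      (\<Sum>k | even k \<and> xs k \<noteq> []. mset (xs k), \<Sum>k | odd k \<and> xs k \<noteq> []. mset (xs k)) =
      (\<Sum>k | even k \<and> barcode n (P k) \<noteq> {#}. barcode n (P k),
       \<Sum>k | odd k \<and> barcode n (P k) \<noteq> {#}. barcode n (P k))"
    by (rule exI[of _ "\<lambda>k. free_sum (xs k)"], rule exI[of _ d], rule exI[of _ e])
      (use minimal_if_radical_resolution[OF M R] in \<open>simp add: xs\<close>)
next
  fix b assume "\<exists>P d e. minimal_projective_resolution n M P d e \<and>
      b = (\<Sum>k | even k \<and> barcode n (P k) \<noteq> {#}. barcode n (P k),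
       \<Sum>k | odd k \<and> barcode n (P k) \<noteq> {#}. barcode n (P k))"
  then obtain P d' e' where P: "minimal_projective_resolution n M P d' e'"
    and b: "b = (\<Sum>k | even k \<and> barcode n (P k) \<noteq> {#}. barcode n (P k),
       \<Sum>k | odd k \<and> barcode n (P k) \<noteq> {#}. barcode n (P k))" by blast
  have "barcode n (P k) = mset (xs k)" for k by (rule minimal_barcode_unique[OF M R P])
  then show "b = (\<Sum>k | even k \<and> xs k \<noteq> []. mset (xs k), \<Sum>k | odd k \<and> xs k \<noteq> []. mset (xs k))"
    unfolding b by simp
qed

section \<open>Modules that change at finitely many points only\<close>

text \<open>
  Every finitely presentable module is tame for some finite \<open>X\<close>. Tameness passes to kernels and
  implies finite generation by generators in a finite set that depends on \<open>X\<close> only, which is what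
  an iterated construction of syzygies requires.
\<close>

definition tame :: "nat \<Rightarrow> real vec set \<Rightarrow> 'k::field pmod \<Rightarrow> bool" where
  "tame n X M \<longleftrightarrow>
     (\<forall>r\<in>Rn n. (\<forall>x\<in>X. \<not> x \<le> r) \<longrightarrow> obj M r = {0}) \<and>
     (\<forall>r\<in>Rn n. \<forall>s\<in>Rn n. r \<le> s \<longrightarrow> (\<forall>x\<in>X. x \<le> s \<longrightarrow> x \<le> r) \<longrightarrow>
        bij_betw (str M r s) (obj M r) (obj M s))"

lemma tame_zero: "tame n X M \<Longrightarrow> r \<in> Rn n \<Longrightarrow> (\<And>x. x \<in> X \<Longrightarrow> \<not> x \<le> r) \<Longrightarrow> obj M r = {0}"
  unfolding tame_def by simp

lemma tame_bij:
  "tame n X M \<Longrightarrow> r \<in> Rn n \<Longrightarrow> s \<in> Rn n \<Longrightarrow> r \<le> s \<Longrightarrow> (\<And>x. x \<in> X \<Longrightarrow> x \<le> s \<Longrightarrow> x \<le> r) \<Longrightarrow>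
    bij_betw (str M r s) (obj M r) (obj M s)"
  unfolding tame_def by simp

definition join :: "nat \<Rightarrow> real vec set \<Rightarrow> real vec" where
  "join n S = vec n (\<lambda>i. Max ((\<lambda>x. x $ i) ` S))"

definition joins :: "nat \<Rightarrow> real vec set \<Rightarrow> real vec set" where
  "joins n X = join n ` {S. S \<subseteq> X \<and> S \<noteq> {}}"

lemma join_in_Rn: "join n S \<in> Rn n"
  unfolding join_def by simp

lemma joins_subset_Rn: "joins n X \<subseteq> Rn n"
  unfolding joins_def using join_in_Rn by auto

lemma finite_joins: "finite X \<Longrightarrow> finite (joins n X)"
  unfolding joins_def by simp

lemma subset_joins:
  assumes "X \<subseteq> Rn n"
  shows "X \<subseteq> joins n X"
proof
  fix x assume x: "x \<in> X"
  have "join n {x} = x"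
    using x assms unfolding join_def by (intro eq_vecI) auto
  then show "x \<in> joins n X" using x unfolding joins_def by force
qed

lemma join_le_iff:
  assumes "finite S" "S \<noteq> {}" "S \<subseteq> Rn n" "r \<in> Rn n"
  shows "join n S \<le> r \<longleftrightarrow> (\<forall>x\<in>S. x \<le> r)"
proof -
  have "dim_vec x = n" if "x \<in> S" for x using assms(3) that by auto
  moreover have "dim_vec r = n" using assms(4) by simp
  ultimately show ?thesis
    using assms(1,2) unfolding join_def less_eq_vec_def by auto
qed

lemma tame_free_sum:
  assumes X: "finite X" "X \<subseteq> Rn n" and xs: "set xs \<subseteq> joins n X"
  shows "tame n X (free_sum xs)"
proof -
  have le: "\<exists>S. S \<subseteq> X \<and> S \<noteq> {} \<and> (\<forall>r\<in>Rn n. xs ! m \<le> r \<longleftrightarrow> (\<forall>x\<in>S. x \<le> r))"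
    if "m < length xs" for m
  proof -
    have "xs ! m \<in> joins n X" using that xs by auto
    then obtain S where S: "S \<subseteq> X" "S \<noteq> {}" "xs ! m = join n S" unfolding joins_def by auto
    have "xs ! m \<le> r \<longleftrightarrow> (\<forall>x\<in>S. x \<le> r)" if "r \<in> Rn n" for r
      unfolding S(3) using finite_subset[OF S(1) X(1)] S(2) subset_trans[OF S(1) X(2)] that
      by (rule join_le_iff)
    then show ?thesis using S(1,2) by blast
  qed
  show ?thesis
    unfolding tame_def
  proof (intro conjI ballI impI)
    fix r assume "r \<in> Rn n" "\<forall>x\<in>X. \<not> x \<le> r"
    then have "below xs r = {}" using le by blast
    then show "obj (free_sum xs) r = {0}"
      unfolding obj_free_sum coord_space_def by (auto simp: fun_eq_iff)
  next
    fix r s assume rs: "r \<in> Rn n" "s \<in> Rn n" "r \<le> s" and X: "\<forall>x\<in>X. x \<le> s \<longrightarrow> x \<le> r"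
    have "xs ! m \<le> r \<longleftrightarrow> xs ! m \<le> s" if m: "m < length xs" for m
    proof -
      obtain S where S: "S \<subseteq> X" "\<And>r. r \<in> Rn n \<Longrightarrow> xs ! m \<le> r \<longleftrightarrow> (\<forall>x\<in>S. x \<le> r)"
        using le[OF m] by blast
      have "x \<le> r \<longleftrightarrow> x \<le> s" if "x \<in> S" for x
        using that S(1) X order_trans[OF _ rs(3), of x] by blast
      then show ?thesis using S(2)[OF rs(1)] S(2)[OF rs(2)] by simp
    qed
    then have "below xs r = below xs s" by blast
    then show "bij_betw (str (free_sum xs) r s) (obj (free_sum xs) r) (obj (free_sum xs) s)"
      unfolding obj_free_sum by (simp add: bij_betw_def)
  qed
qed

abbreviation kernel :: "'k::field pmod \<Rightarrow> 'k pmor \<Rightarrow> 'k pmod" where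
  "kernel A f \<equiv> submodule A (\<lambda>r. {x \<in> obj A r. f r x = 0})"

lemma hom_into_submodule:
  assumes f: "pmod_hom n A (submodule B U) f" and U: "\<And>r. U r \<subseteq> obj B r"
  shows "pmod_hom n A B f"
proof -
  have "linear_map (obj A r) (obj B r) (f r)" if "r \<in> Rn n" for r
    using hom_lin[OF f that] U[of r] by (simp add: linear_map_def subset_iff)
  then show ?thesis using hom_nat[OF f] by (simp add: pmod_hom_def)
qed

lemma pm_kernel:
  assumes A: "persistence_module n A" and B: "persistence_module n B" and f: "pmod_hom n A B f"
  shows "persistence_module n (kernel A f)"
proof (rule pm_submodule[OF A])
  fix r s x assume rs: "r \<in> Rn n" "s \<in> Rn n" "r \<le> s" and x: "x \<in> {x \<in> obj A r. f r x = 0}"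
  then have "f s (str A r s x) = str B r s 0" using hom_nat[OF f rs] by simp
  also have "\<dots> = 0" using linear_map_zero[OF pm_str pm_subspace] B rs by blast
  finally show "str A r s x \<in> {x \<in> obj A s. f s x = 0}" using pm_str_in[OF A rs] x by simp
qed (use subspace_kernel[OF hom_lin[OF f] pm_subspace[OF A]] in auto)

lemma tame_kernel:
  assumes A: "persistence_module n A" "tame n X A" and B: "persistence_module n B" "tame n X B"
    and f: "pmod_hom n A B f"
  shows "tame n X (kernel A f)"
  unfolding tame_def submodule_simps
proof (intro conjI ballI impI)
  fix r assume r: "r \<in> Rn n" "\<forall>x\<in>X. \<not> x \<le> r"
  then have "obj A r = {0}" using tame_zero[OF A(2) r(1)] by blast
  then show "{x \<in> obj A r. f r x = 0} = {0}" using hom_zero[OF f A(1) r(1)] by auto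
next
  fix r s assume rs: "r \<in> Rn n" "s \<in> Rn n" "r \<le> s" and "\<forall>x\<in>X. x \<le> s \<longrightarrow> x \<le> r"
  then have bA: "bij_betw (str A r s) (obj A r) (obj A s)"
    and bB: "bij_betw (str B r s) (obj B r) (obj B s)"
    using tame_bij[OF A(2) rs] tame_bij[OF B(2) rs] by blast+
  have "f s (str A r s x) = 0 \<longleftrightarrow> f r x = 0" if x: "x \<in> obj A r" for x
  proof -
    have "str B r s 0 = 0" using linear_map_zero[OF pm_str[OF B(1) rs] pm_subspace[OF B(1) rs(1)]] .
    moreover have "0 \<in> obj B r" using kvs.subspace_0[OF pm_subspace[OF B(1) rs(1)]] .
    ultimately have "str B r s (f r x) = 0 \<longleftrightarrow> f r x = 0"
      using inj_on_eq_iff[OF bij_betw_imp_inj_on[OF bB] hom_in[OF f rs(1) x]] by metis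
    then show ?thesis using hom_nat[OF f rs x] by simp
  qed
  then have "str A r s ` {x \<in> obj A r. f r x = 0} = {x \<in> str A r s ` obj A r. f s x = 0}"
    by auto
  then have "str A r s ` {x \<in> obj A r. f r x = 0} = {x \<in> obj A s. f s x = 0}"
    unfolding bij_betw_imp_surj_on[OF bA] .
  moreover have "inj_on (str A r s) {x \<in> obj A r. f r x = 0}"
    using bij_betw_imp_inj_on[OF bA] by (rule inj_on_subset) auto
  ultimately show "bij_betw (str A r s) {x \<in> obj A r. f r x = 0} {x \<in> obj A s. f s x = 0}"
    unfolding bij_betw_def by blast
qed

text \<open>A pointwise five lemma for the structure maps.\<close>

lemma tame_cokernel:
  assumes A: "persistence_module n A" "tame n X A" and B: "persistence_module n B" "tame n X B"
    and M: "persistence_module n M"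
    and f: "pmod_hom n A B f" and p: "pmod_epi n B M p" and ex: "exact_at n A f B p"
  shows "tame n X M"
  unfolding tame_def
proof (intro conjI ballI impI)
  have hp: "pmod_hom n B M p" and sp: "\<And>r. r \<in> Rn n \<Longrightarrow> p r ` obj B r = obj M r"
    using p unfolding pmod_epi_def by auto
  have ker: "\<And>r. r \<in> Rn n \<Longrightarrow> f r ` obj A r = {x \<in> obj B r. p r x = 0}"
    using ex unfolding exact_at_def by auto
  {
    fix r assume r: "r \<in> Rn n" "\<forall>x\<in>X. \<not> x \<le> r"
    then have "obj B r = {0}" using tame_zero[OF B(2) r(1)] by blast
    then show "obj M r = {0}" using hom_zero[OF hp B(1) r(1)] sp[OF r(1)] by auto
  next
    fix r s assume rs: "r \<in> Rn n" "s \<in> Rn n" "r \<le> s" and "\<forall>x\<in>X. x \<le> s \<longrightarrow> x \<le> r"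
    then have bA: "bij_betw (str A r s) (obj A r) (obj A s)"
      and bB: "bij_betw (str B r s) (obj B r) (obj B s)"
      using tame_bij[OF A(2) rs] tame_bij[OF B(2) rs] by blast+
    have "obj M s = (\<lambda>x. p s (str B r s x)) ` obj B r"
      unfolding sp[OF rs(2), symmetric] bij_betw_imp_surj_on[OF bB, symmetric] image_image ..
    also have "\<dots> = (\<lambda>x. str M r s (p r x)) ` obj B r"
      using hom_nat[OF hp rs] by simp
    finally have "str M r s ` obj M r = obj M s"
      unfolding sp[OF rs(1), symmetric] image_image by (rule sym)
    moreover have "x = y" if x: "x \<in> obj M r" and y: "y \<in> obj M r" and xy: "str M r s x = str M r s y" for x y
    proof -
      have "x - y \<in> obj M r" using x y kvs.subspace_diff[OF pm_subspace[OF M rs(1)]] by simp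
      then have "x - y \<in> p r ` obj B r" unfolding sp[OF rs(1)] .
      then obtain b where b: "b \<in> obj B r" "p r b = x - y" by (rule imageE) simp
      have "p s (str B r s b) = 0"
        using hom_nat[OF hp rs b(1)] b(2) xy
          linear_map_diff[OF pm_str[OF M rs] pm_subspace[OF M rs(1)] x y] by simp
      then have "str B r s b \<in> f s ` obj A s" using ker[OF rs(2)] pm_str_in[OF B(1) rs b(1)] by simp
      then obtain a where a: "a \<in> obj A r" "str B r s b = f s (str A r s a)"
        using bij_betw_imp_surj_on[OF bA] by force
      then have "str B r s b = str B r s (f r a)" using hom_nat[OF f rs a(1)] by simp
      then have "b = f r a"
        using inj_on_eq_iff[OF bij_betw_imp_inj_on[OF bB] b(1) hom_in[OF f rs(1) a(1)]] by simp
      then have "p r b = 0" using ker[OF rs(1)] a(1) by blast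
      then show "x = y" using b(2) by simp
    qed
    ultimately show "bij_betw (str M r s) (obj M r) (obj M s)"
      unfolding bij_betw_def inj_on_def by blast
  }
qed

lemma tame_if_finitely_presentable:
  fixes M :: "'k::field pmod"
  assumes "finitely_presentable n M"
  obtains X where "finite X" "X \<subseteq> Rn n" "tame n X M"
proof -
  obtain P1 P0 f p where M: "persistence_module n M" and fin: "finite_free n P1" "finite_free n P0"
    and f: "pmod_hom n P1 P0 f" and p: "pmod_epi n P0 M p" "exact_at n P1 f P0 p"
    using assms unfolding finitely_presentable_def by blast
  have free: "\<exists>xs. set xs \<subseteq> Rn n \<and> persistence_module n P \<and>
      (\<exists>g g'. pmod_hom n P (free_sum xs) g \<and> pmod_hom n (free_sum xs) P g' \<and>
        (\<forall>r\<in>Rn n. \<forall>x\<in>obj P r. g' r (g r x) = x) \<and>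
        (\<forall>r\<in>Rn n. \<forall>y\<in>obj (free_sum xs) r. g r (g' r y) = y))"
    if P: "finite_free n P" for P :: "'k pmod"
    using finite_free_barcode[OF P] unfolding free_with_barcode_def pmod_iso_def
    by (metis set_mset_mset)
  have tame_free: "tame n X P"
    if xs: "set xs \<subseteq> X" and X: "finite X" "X \<subseteq> Rn n" and P: "persistence_module n P"
      and g: "pmod_hom n P (free_sum xs) g" "pmod_hom n (free_sum xs) P g'"
        "\<forall>r\<in>Rn n. \<forall>x\<in>obj P r. g' r (g r x) = x"
        "\<forall>r\<in>Rn n. \<forall>y\<in>obj (free_sum xs) r. g r (g' r y) = y"
    for xs X and P :: "'k pmod" and g g'
  proof (rule tame_cokernel[OF pm_free_sum _ pm_free_sum _ P])
    \<comment> \<open>\<open>P\<close> is the cokernel of \<open>0 \<rightarrow> free_sum xs\<close>.\<close>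
    show "tame n X (free_sum [] :: 'k pmod)" by (rule tame_free_sum[OF X]) simp
    show "tame n X (free_sum xs :: 'k pmod)"
      using xs subset_joins[OF X(2)] by (intro tame_free_sum[OF X]) blast
    show "pmod_hom n (free_sum []) (free_sum xs :: 'k pmod) (\<lambda>r x. x)"
      unfolding pmod_hom_def linear_map_def by (auto simp: obj_free_sum coord_space_def)
    show "pmod_epi n (free_sum xs) P g'"
      unfolding pmod_epi_def using g hom_in[OF g(1)] hom_in[OF g(2)] by (auto simp: image_iff) metis
    show "exact_at n (free_sum []) (\<lambda>r x. x) (free_sum xs) g'"
      unfolding exact_at_def
    proof
      fix r assume r: "r \<in> Rn n"
      have "y = 0" if "y \<in> obj (free_sum xs) r" "g' r y = 0" for y
        using g(4) r that hom_zero[OF g(1) P r] by metis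
      moreover have "0 \<in> obj (free_sum xs :: 'k pmod) r" by (simp add: obj_free_sum coord_space_def)
      ultimately have "{y \<in> obj (free_sum xs) r. g' r y = 0} = {0}"
        using hom_zero[OF g(2) pm_free_sum r] by blast
      moreover have "obj (free_sum [] :: 'k pmod) r = {0}"
        by (auto simp: obj_free_sum coord_space_def fun_eq_iff)
      ultimately show "(\<lambda>x. x) ` obj (free_sum []) r = {y \<in> obj (free_sum xs) r. g' r y = 0}"
        by simp
    qed
  qed
  obtain xs1 g1 g1' where 1: "set xs1 \<subseteq> Rn n" "persistence_module n P1"
    "pmod_hom n P1 (free_sum xs1) g1" "pmod_hom n (free_sum xs1) P1 g1'"
    "\<forall>r\<in>Rn n. \<forall>x\<in>obj P1 r. g1' r (g1 r x) = x"
    "\<forall>r\<in>Rn n. \<forall>y\<in>obj (free_sum xs1) r. g1 r (g1' r y) = y"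
    using free[OF fin(1)] by blast
  obtain xs0 g0 g0' where 0: "set xs0 \<subseteq> Rn n" "persistence_module n P0"
    "pmod_hom n P0 (free_sum xs0) g0" "pmod_hom n (free_sum xs0) P0 g0'"
    "\<forall>r\<in>Rn n. \<forall>x\<in>obj P0 r. g0' r (g0 r x) = x"
    "\<forall>r\<in>Rn n. \<forall>y\<in>obj (free_sum xs0) r. g0 r (g0' r y) = y"
    using free[OF fin(2)] by blast
  let ?X = "set xs0 \<union> set xs1"
  have X: "finite ?X" "?X \<subseteq> Rn n" using 0(1) 1(1) by auto
  have "tame n ?X P1" by (rule tame_free[OF _ X 1(2-6)]) simp
  moreover have "tame n ?X P0" by (rule tame_free[OF _ X 0(2-6)]) simp
  ultimately have "tame n ?X M" using tame_cokernel[OF 1(2) _ 0(2) _ M f p] by blast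
  then show thesis using that X by blast
qed

subsection \<open>Minimal free covers and resolutions\<close>

text \<open>
  The value at \<open>r\<close> comes from the join of the elements of \<open>X\<close> below \<open>r\<close>, so it suffices to add,
  at each of the finitely many joins \<open>g\<close>, generators that form a basis of the value at \<open>g\<close> modulo
  the radical. They generate by induction along the order, and independence modulo the radical
  makes the kernel radical.
\<close>

lemma minimal_free_cover:
  fixes M :: "'k::field pmod"
  assumes M: "persistence_module n M" "tame n X M" and X: "finite X" "X \<subseteq> Rn n"
  obtains xs p where "set xs \<subseteq> joins n X" "pmod_epi n (free_sum xs) M p"
    "\<And>r v. r \<in> Rn n \<Longrightarrow> v \<in> obj (free_sum xs) r \<Longrightarrow> p r v = 0 \<Longrightarrow> v \<in> radical n (free_sum xs) r"
proof -
  let ?G = "joins n X"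
  have G: "finite ?G" "?G \<subseteq> Rn n" by (rule finite_joins[OF X(1)], rule joins_subset_Rn)
  define basis_mod where "basis_mod g B \<longleftrightarrow> finite B \<and> B \<subseteq> obj M g \<and>
      obj M g = kvs.span (radical n M g \<union> B) \<and>
      (\<forall>c. (\<Sum>b\<in>B. vscale (c b) b) \<in> radical n M g \<longrightarrow> (\<forall>b\<in>B. c b = 0))" for g B
  have "\<exists>B. basis_mod g B" if "g \<in> Rn n" for g
    unfolding basis_mod_def
    by (rule basis_modulo_subspace[OF pm_fd[OF M(1) that] subspace_radical
          radical_subset[OF M(1) that]]) blast
  then obtain B where "\<And>g. g \<in> Rn n \<Longrightarrow> basis_mod g (B g)" by metis
  then have B: "\<And>g. g \<in> Rn n \<Longrightarrow> finite (B g)" "\<And>g. g \<in> Rn n \<Longrightarrow> B g \<subseteq> obj M g"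
    "\<And>g. g \<in> Rn n \<Longrightarrow> obj M g = kvs.span (radical n M g \<union> B g)"
    "\<And>g c b. g \<in> Rn n \<Longrightarrow> (\<Sum>b\<in>B g. vscale (c b) b) \<in> radical n M g \<Longrightarrow> b \<in> B g \<Longrightarrow> c b = 0"
    unfolding basis_mod_def by blast+
  have "finite (Sigma ?G B)" using G B(1) by (intro finite_SigmaI) auto
  then obtain L where L: "set L = Sigma ?G B" "distinct L" using finite_distinct_list by blast
  define xs where "xs = map fst L"
  define a where "a m = snd (L ! m)" for m
  have nth: "xs ! m \<in> ?G" "a m \<in> B (xs ! m)" if "m < length xs" for m
  proof -
    have "L ! m \<in> Sigma ?G B" using that nth_mem[of m L] unfolding xs_def L(1) by simp
    then show "xs ! m \<in> ?G" "a m \<in> B (xs ! m)" using that unfolding xs_def a_def by auto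
  qed
  have xsG: "set xs \<subseteq> ?G" unfolding xs_def using L(1) by auto
  then have xs: "set xs \<subseteq> Rn n" using G(2) by blast
  have nthR: "xs ! m \<in> Rn n" if "m < length xs" for m using nth(1)[OF that] G(2) by blast
  define p where "p = free_hom xs M a"
  have aM: "a m \<in> obj M (xs ! m)" if "m < length xs" for m using nth[OF that] B(2) nthR[OF that] by blast
  have p: "pmod_hom n (free_sum xs) M p"
    unfolding p_def by (rule free_hom_hom[OF M(1) xs aM])
  \<comment> \<open>The number of elements of \<open>X\<close> below the point drops strictly from a join \<open>g\<close> to any \<open>s < g\<close>.\<close>
  have surj: "obj M r \<subseteq> p r ` obj (free_sum xs) r" if "r \<in> Rn n" for r
    using that
  proof (induction "card {x \<in> X. x \<le> r}" arbitrary: r rule: less_induct)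
    case less
    note r = less.prems
    show ?case
    proof (cases "{x \<in> X. x \<le> r} = {}")
      case True
      then have "obj M r = {0}" using tame_zero[OF M(2) r] by blast
      then show ?thesis
        using kvs.subspace_0[OF hom_image_subspace[OF p pm_free_sum r]] by simp
    next
      case False
      define g where "g = join n {x \<in> X. x \<le> r}"
      have gG: "g \<in> ?G" unfolding g_def joins_def using False by blast
      have g: "g \<in> Rn n" unfolding g_def by (rule join_in_Rn)
      have g_le: "g \<le> s \<longleftrightarrow> (\<forall>x\<in>X. x \<le> r \<longrightarrow> x \<le> s)" if "s \<in> Rn n" for s
        unfolding g_def using join_le_iff[OF _ False _ that] X by auto
      have gr: "g \<le> r" using g_le[OF r] by blast
      have same: "x \<le> g \<longleftrightarrow> x \<le> r" if "x \<in> X" for x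
        using g_le[OF g] gr that by (meson order_refl order_trans)
      let ?I = "p g ` obj (free_sum xs) g"
      have sI: "kvs.subspace ?I" by (rule hom_image_subspace[OF p pm_free_sum g])
      have "str M s g y \<in> ?I" if s: "s \<in> Rn n" "s \<le> g" "s \<noteq> g" and y: "y \<in> obj M s" for s y
      proof -
        have "\<not> g \<le> s" using s by (auto dest: order.antisym)
        then obtain x where "x \<in> X" "x \<le> r" "\<not> x \<le> s" using g_le[OF s(1)] by blast
        then have "{x \<in> X. x \<le> s} \<subset> {x \<in> X. x \<le> r}"
          using s(2) gr by (blast intro: order_trans)
        then have "card {x \<in> X. x \<le> s} < card {x \<in> X. x \<le> r}"
          using X(1) by (intro psubset_card_mono) auto
        then obtain v where v: "v \<in> obj (free_sum xs) s" "y = p s v"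
          using less.hyps s(1) y by blast
        then have "str M s g y = p g v" using hom_nat[OF p s(1) g s(2) v(1)] by simp
        then show ?thesis using free_sum_mono[OF s(2)] v(1) by blast
      qed
      then have "radical n M g \<subseteq> ?I"
        unfolding radical_def by (intro kvs.span_minimal sI) auto
      moreover have "B g \<subseteq> ?I"
      proof
        fix b assume b: "b \<in> B g"
        then have "(g, b) \<in> set L" using gG L(1) by blast
        then obtain m where m: "m < length xs" "xs ! m = g" "a m = b"
          unfolding xs_def a_def by (auto simp: in_set_conv_nth)
        then have "p g (unit_at m) = b"
          unfolding p_def using free_hom_unit_at[of m xs g M a] pm_id[OF M(1) g, of b] B(2)[OF g] b by auto
        then show "b \<in> ?I" using unit_at_in_free_sum[of m xs g] m by blast
      qed
      ultimately have "obj M g \<subseteq> ?I" using B(3)[OF g] kvs.span_minimal[OF _ sI] by (metis Un_least)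
      have "obj M r = str M g r ` obj M g"
        using bij_betw_imp_surj_on[OF tame_bij[OF M(2) g r gr]] same by blast
      also have "\<dots> \<subseteq> p r ` obj (free_sum xs) r"
      proof
        fix y assume "y \<in> str M g r ` obj M g"
        then obtain v where v: "v \<in> obj (free_sum xs) g" "y = str M g r (p g v)"
          using \<open>obj M g \<subseteq> ?I\<close> by blast
        then have "y = p r v" using hom_nat[OF p g r gr v(1)] by simp
        then show "y \<in> p r ` obj (free_sum xs) r" using free_sum_mono[OF gr] v(1) by blast
      qed
      finally show ?thesis .
    qed
  qed
  have epi: "pmod_epi n (free_sum xs) M p"
    unfolding pmod_epi_def using p surj hom_in[OF p] by blast
  have rad: "v \<in> radical n (free_sum xs) r"
    if r: "r \<in> Rn n" and v: "v \<in> obj (free_sum xs) r" and pv: "p r v = 0" for r v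
  proof -
    let ?I = "{m. m < length xs \<and> xs ! m = r}" and ?J = "{m \<in> below xs r. xs ! m \<noteq> r}"
    have bij: "bij_betw a ?I (B r)" if "r \<in> ?G"
    proof (rule bij_betwI')
      fix i j assume ij: "i \<in> ?I" "j \<in> ?I"
      then have "L ! i = (r, a i)" "L ! j = (r, a j)" unfolding xs_def a_def by (auto simp: prod_eq_iff)
      then show "a i = a j \<longleftrightarrow> i = j"
        using ij L(2) unfolding xs_def by (auto simp: nth_eq_iff_index_eq)
    next
      fix b assume "b \<in> B r"
      then have "(r, b) \<in> set L" using that L(1) by blast
      then show "\<exists>m\<in>?I. b = a m" unfolding xs_def a_def by (auto simp: in_set_conv_nth)
    qed (use nth in auto)
    \<comment> \<open>In \<open>p r v = 0\<close> the generators below \<open>r\<close> contribute to the radical, hence so do those at \<open>r\<close>.\<close>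
    define w where "w m = vscale (v m) (str M (xs ! m) r (a m))" for m
    have "0 = (\<Sum>m\<in>below xs r. w m)" using pv unfolding p_def free_hom_def w_def by simp
    also have "\<dots> = (\<Sum>m\<in>?I \<union> ?J. w m)" by (rule sum.cong) auto
    also have "\<dots> = (\<Sum>m\<in>?I. w m) + (\<Sum>m\<in>?J. w m)" by (rule sum.union_disjoint) auto
    finally have "(\<Sum>m\<in>?I. w m) = - (\<Sum>m\<in>?J. w m)"
      by (intro eq_neg_iff_add_eq_0[THEN iffD2]) (rule sym)
    moreover have "(\<Sum>m\<in>?J. w m) \<in> radical n M r"
      unfolding w_def using nthR aM
      by (intro kvs.subspace_sum kvs.subspace_scale subspace_radical radical_base) auto
    ultimately have sum_rad: "(\<Sum>m\<in>?I. w m) \<in> radical n M r"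
      using kvs.subspace_neg[OF subspace_radical] by (simp del: uminus_apply)
    have v0: "v m = 0" if m: "m \<in> ?I" for m
    proof -
      have rG: "r \<in> ?G" using m nth(1) by blast
      define c where "c b = v (the_inv_into ?I a b)" for b
      have c: "c (a i) = v i" if "i \<in> ?I" for i
        unfolding c_def using the_inv_into_f_f[OF bij_betw_imp_inj_on[OF bij[OF rG]] that] by simp
      have "(\<Sum>b\<in>B r. vscale (c b) b) = (\<Sum>i\<in>?I. vscale (c (a i)) (a i))"
        by (rule sum.reindex_bij_betw[OF bij[OF rG], symmetric])
      also have "\<dots> = (\<Sum>i\<in>?I. w i)"
        using c pm_id[OF M(1) r] aM by (intro sum.cong) (auto simp: w_def)
      finally have "(\<Sum>b\<in>B r. vscale (c b) b) \<in> radical n M r" using sum_rad by simp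
      then have "c (a m) = 0" using B(4)[OF r] bij_betw_apply[OF bij[OF rG] m] by blast
      then show "v m = 0" using c[OF m] by simp
    qed
    then show ?thesis
      using v unfolding radical_free_sum[OF xs r] obj_free_sum coord_space_def by auto
  qed
  show thesis using that[OF xsG epi rad] .
qed

lemma radical_resolution_exists:
  fixes M :: "'k::field pmod"
  assumes M: "persistence_module n M" "tame n X M" and X: "finite X" "X \<subseteq> Rn n"
  obtains xs d e where "radical_resolution n M xs d e" "\<And>k. set (xs k) \<subseteq> joins n X"
proof -
  \<comment> \<open>A state is a syzygy together with a minimal free cover of it; the next syzygy is the kernel.\<close>
  define A where "A k st \<longleftrightarrow> (case st of (N, xs, p) \<Rightarrow>
    persistence_module n N \<and> tame n X N \<and> set xs \<subseteq> joins n X \<and> pmod_epi n (free_sum xs) N p \<and>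
    (\<forall>r\<in>Rn n. \<forall>v\<in>obj (free_sum xs) r. p r v = 0 \<longrightarrow> v \<in> radical n (free_sum xs) r) \<and>
    (k = 0 \<longrightarrow> N = M))" for k :: nat and st :: "'k pmod \<times> real vec list \<times> 'k pmor"
  define T where "T k st st' \<longleftrightarrow> (case st of (N, xs, p) \<Rightarrow> fst st' = kernel (free_sum xs) p)"
    for k :: nat and st st' :: "'k pmod \<times> real vec list \<times> 'k pmor"
  have "\<exists>st. \<forall>k. A k (st k) \<and> T k (st k) (st (Suc k))"
  proof (rule dependent_nat_choice)
    obtain xs p where "set xs \<subseteq> joins n X" "pmod_epi n (free_sum xs) M p"
      "\<And>r v. r \<in> Rn n \<Longrightarrow> v \<in> obj (free_sum xs) r \<Longrightarrow> p r v = 0 \<Longrightarrow> v \<in> radical n (free_sum xs) r"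
      using minimal_free_cover[OF M X] by blast
    then have "A 0 (M, xs, p)" unfolding A_def using M by simp
    then show "\<exists>st. A 0 st" by blast
  next
    fix st k assume st: "A k st"
    obtain N xs p where st_eq: "st = (N, xs, p)" by (cases st)
    have N: "persistence_module n N" "tame n X N" and xs: "set xs \<subseteq> joins n X"
      and p: "pmod_hom n (free_sum xs) N p"
      using st unfolding A_def st_eq pmod_epi_def by auto
    let ?K = "kernel (free_sum xs) p"
    have K: "persistence_module n ?K" "tame n X ?K"
      using pm_kernel[OF pm_free_sum N(1) p]
        tame_kernel[OF pm_free_sum tame_free_sum[OF X xs] N p] by auto
    obtain ys q where "set ys \<subseteq> joins n X" "pmod_epi n (free_sum ys) ?K q"
      "\<And>r v. r \<in> Rn n \<Longrightarrow> v \<in> obj (free_sum ys) r \<Longrightarrow> q r v = 0 \<Longrightarrow> v \<in> radical n (free_sum ys) r"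
      using minimal_free_cover[OF K X] by blast
    then have "A (Suc k) (?K, ys, q)" unfolding A_def using K by simp
    then show "\<exists>st'. A (Suc k) st' \<and> T k st st'" unfolding T_def st_eq by force
  qed
  then obtain st where st: "\<And>k. A k (st k)" "\<And>k. T k (st k) (st (Suc k))" by blast
  define N xs p where "N k = fst (st k)" and "xs k = fst (snd (st k))" and "p k = snd (snd (st k))" for k
  have A: "persistence_module n (N k)" "set (xs k) \<subseteq> joins n X"
    "pmod_hom n (free_sum (xs k)) (N k) (p k)"
    "\<And>r. r \<in> Rn n \<Longrightarrow> p k r ` obj (free_sum (xs k)) r = obj (N k) r"
    "\<And>r v. r \<in> Rn n \<Longrightarrow> v \<in> obj (free_sum (xs k)) r \<Longrightarrow> p k r v = 0 \<Longrightarrow>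
      v \<in> radical n (free_sum (xs k)) r" for k
    using st(1)[of k] unfolding A_def N_def xs_def p_def pmod_epi_def by (auto split: prod.splits)
  have N0: "N 0 = M" using st(1)[of 0] unfolding A_def N_def by (auto split: prod.splits)
  have NS: "N (Suc k) = kernel (free_sum (xs k)) (p k)" for k
    using st(2)[of k] unfolding T_def N_def xs_def p_def by (auto split: prod.splits)
  have xs: "set (xs k) \<subseteq> Rn n" for k using A(2) joins_subset_Rn by blast
  have image: "p (Suc k) r ` obj (free_sum (xs (Suc k))) r = {v \<in> obj (free_sum (xs k)) r. p k r v = 0}"
    if "r \<in> Rn n" for k r using A(4)[OF that, of "Suc k"] unfolding NS by simp
  have hom: "pmod_hom n (free_sum (xs (Suc k))) (free_sum (xs k)) (p (Suc k))" for k
    by (rule hom_into_submodule[OF A(3)[of "Suc k", unfolded NS]]) blast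
  have proj: "projective n (free_sum (xs k) :: 'k pmod)" for k
    by (rule projective_free_sum[OF xs])
  have "pmod_epi n (free_sum (xs 0)) M (p 0)"
    using A(3)[of 0] A(4)[of _ 0] unfolding N0 pmod_epi_def by blast
  then have "projective_resolution n M (\<lambda>k. free_sum (xs k)) (\<lambda>k. p (Suc k)) (p 0)"
    unfolding projective_resolution_def exact_at_def
    using proj hom image by simp
  moreover have "p (Suc k) r ` obj (free_sum (xs (Suc k))) r \<subseteq> radical n (free_sum (xs k)) r"
    if "r \<in> Rn n" for k r unfolding image[OF that] using A(5)[OF that] by blast
  ultimately have "radical_resolution n M xs (\<lambda>k. p (Suc k)) (p 0)"
    unfolding radical_resolution_def using xs by blast
  then show thesis using that A(2) by blast
qed

text \<open>
  By exactness the kernels of the differentials are radical as well, and radicals contain no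
  generators. So a differential sends each generator to a nonzero combination of generators at
  strictly smaller points. Hence a generator of the \<open>k\<close>-th term sits on top of a chain of \<open>k\<close>
  further points, and chains in a finite set of points have bounded length.
\<close>

lemma radical_resolution_finite_length:
  fixes M :: "'k::field pmod"
  assumes R: "radical_resolution n M xs d e" and G: "finite G" "\<And>k. set (xs k) \<subseteq> G"
    and k: "card G \<le> k"
  shows "xs k = []"
proof -
  have xs: "\<And>k. set (xs k) \<subseteq> Rn n"
    and P: "projective_resolution n M (\<lambda>k. free_sum (xs k)) d e"
    and rad: "\<And>k r. r \<in> Rn n \<Longrightarrow>
      d k r ` obj (free_sum (xs (Suc k))) r \<subseteq> radical n (free_sum (xs k)) r"
    using R unfolding radical_resolution_def by blast+
  have chain: "k \<le> card {h \<in> G. h \<le> g \<and> h \<noteq> g}" if "g \<in> set (xs k)" for k g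
    using that
  proof (induction k arbitrary: g)
    case (Suc k)
    obtain m where m: "m < length (xs (Suc k))" "xs (Suc k) ! m = g"
      using Suc.prems by (auto simp: in_set_conv_nth)
    have g: "g \<in> Rn n" using xs Suc.prems by blast
    let ?u = "unit_at m :: nat \<Rightarrow> 'k"
    have u: "?u \<in> obj (free_sum (xs (Suc k))) g" 
      by (rule unit_at_in_free_sum[OF m(1)]) (simp add: m(2))
    have "d k g ?u \<noteq> 0"
    proof
      assume "d k g ?u = 0"
      then have "?u \<in> d (Suc k) g ` obj (free_sum (xs (Suc (Suc k)))) g"
        unfolding resolution_exact[OF P g] using u by simp
      then have "?u \<in> radical n (free_sum (xs (Suc k))) g" using rad[OF g] by blast
      then have "?u m = 0" unfolding radical_free_sum[OF xs g] coord_space_def using m by blast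
      then show False by (simp add: unit_at_def)
    qed
    then obtain i where i: "d k g ?u i \<noteq> 0" by (auto simp: fun_eq_iff)
    have "d k g ?u \<in> radical n (free_sum (xs k)) g" using rad[OF g] u by blast
    then have "i \<in> {i \<in> below (xs k) g. xs k ! i \<noteq> g}"
      using i unfolding radical_free_sum[OF xs g] coord_space_def by blast
    then have h: "xs k ! i \<in> set (xs k)" "xs k ! i \<le> g" "xs k ! i \<noteq> g" by auto
    let ?h = "xs k ! i"
    have "{h \<in> G. h \<le> ?h \<and> h \<noteq> ?h} \<subset> {h \<in> G. h \<le> g \<and> h \<noteq> g}"
    proof (rule psubsetI)
      show "{h \<in> G. h \<le> ?h \<and> h \<noteq> ?h} \<subseteq> {h \<in> G. h \<le> g \<and> h \<noteq> g}"
        using h by (auto dest: order.antisym order_trans)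
      have "?h \<in> {h \<in> G. h \<le> g \<and> h \<noteq> g}" using h G(2) by blast
      then show "{h \<in> G. h \<le> ?h \<and> h \<noteq> ?h} \<noteq> {h \<in> G. h \<le> g \<and> h \<noteq> g}" by blast
    qed
    then have "card {h \<in> G. h \<le> ?h \<and> h \<noteq> ?h} < card {h \<in> G. h \<le> g \<and> h \<noteq> g}"
      using G(1) by (intro psubset_card_mono) auto
    then show ?case using Suc.IH[OF h(1)] by simp
  qed simp
  have "g \<notin> set (xs k)" for g
  proof
    assume g: "g \<in> set (xs k)"
    then have "{h \<in> G. h \<le> g \<and> h \<noteq> g} \<subset> G" using G(2) by blast
    then have "card {h \<in> G. h \<le> g \<and> h \<noteq> g} < card G" by (rule psubset_card_mono[OF G(1)])
    then show False using chain[OF g] k by simp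
  qed
  then show ?thesis by (cases "xs k") auto
qed

section \<open>The rank of the Betti signed barcode\<close>

text \<open>
  Above all generators a free module has its rank as dimension, so the Euler characteristic of a
  finite free resolution can be read off there.
\<close>

lemma resolution_euler_characteristic:
  fixes M :: "'k::field pmod"
  assumes P: "projective_resolution n M (\<lambda>k. free_sum (xs k)) d e" and r: "r \<in> Rn n"
    and top: "\<And>k g. g \<in> set (xs k) \<Longrightarrow> g \<le> r" and K: "xs K = []"
  shows "kvs.dim (obj M r) + (\<Sum>k<K. if odd k then length (xs k) else 0) =
    (\<Sum>k<K. if even k then length (xs k) else 0)"
proof -
  let ?P = "\<lambda>k. obj (free_sum (xs k) :: 'k pmod) r"
  define z where "z k = kvs.dim {x \<in> ?P k. outgoing e d k r x = 0}" for k
  \<comment> \<open>\<open>b k\<close> is the dimension of the \<open>k\<close>-th syzygy, with \<open>M\<close> as the one of index \<open>0\<close>.\<close>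
  define b where "b k = (if k = 0 then kvs.dim (obj M r) else z (k - 1))" for k
  have fd: "fd_space (?P k)" for k by (rule pm_fd[OF pm_free_sum r])
  have dimP: "kvs.dim (?P k) = length (xs k)" for k
  proof -
    have "below (xs k) r = {..<length (xs k)}" using top[OF nth_mem] by auto
    then show ?thesis by (simp add: obj_free_sum dim_coord_space)
  qed
  have b: "length (xs k) = b k + b (Suc k)" for k
  proof (cases k)
    case 0
    have "e r ` ?P 0 = obj M r" using resolution_epi[OF P] r unfolding pmod_epi_def by blast
    then show ?thesis
      using rank_nullity[OF hom_lin[OF resolution_augmentation[OF P] r] fd] dimP[of 0] 0
      unfolding b_def z_def by simp
  next
    case (Suc j)
    have "kvs.dim (d j r ` ?P (Suc j)) = z j" unfolding z_def resolution_exact[OF P r] ..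
    then show ?thesis
      using rank_nullity[OF hom_lin[OF resolution_hom[OF P] r] fd] dimP[of "Suc j"] Suc
      unfolding b_def z_def by simp
  qed
  have alternating: "b 0 + (\<Sum>k<N. if odd k then length (xs k) else 0) + (if odd N then b N else 0) =
      (\<Sum>k<N. if even k then length (xs k) else 0) + (if even N then b N else 0)" for N
    by (induction N) (use b in \<open>auto split: if_splits\<close>)
  have "b K = 0" using b[of K] K by simp
  then have "b 0 + (\<Sum>k<K. if odd k then length (xs k) else 0) =
      (\<Sum>k<K. if even k then length (xs k) else 0)" using alternating[of K] by (simp only: if_cancel add_0_right)
  then show ?thesis unfolding b_def by simp
qed

lemma size_sum: "size (sum f A) = (\<Sum>a\<in>A. size (f a :: 'a multiset))"
  by (induction A rule: infinite_finite_induct) auto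

text \<open>
  There is a point \<open>t\<close> above all grades at which \<open>M\<close> changes. From there on, the structure maps
  are isomorphisms and the dimension is the Euler characteristic of a minimal resolution.
\<close>

lemma betti_signed_barcode_rank:
  fixes M :: "'k::field pmod"
  assumes fp: "finitely_presentable n M"
  shows "betti_signed_barcode n M \<in> signed_barcodes n"
    and "\<exists>t\<in>Rn n. \<forall>r\<in>Rn n. t \<le> r \<longrightarrow>
      kvs.dim (obj M r) + size (snd (betti_signed_barcode n M)) = size (fst (betti_signed_barcode n M)) \<and>
      (\<forall>s\<in>Rn n. r \<le> s \<longrightarrow> bij_betw (str M r s) (obj M r) (obj M s))"
proof -
  have M: "persistence_module n M" using fp unfolding finitely_presentable_def by blast
  obtain X where X: "finite X" "X \<subseteq> Rn n" and tame: "tame n X M"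
    using tame_if_finitely_presentable[OF fp] by blast
  obtain xs d e where R: "radical_resolution n M xs d e" and G: "\<And>k. set (xs k) \<subseteq> joins n X"
    using radical_resolution_exists[OF M tame X] by blast
  define K where "K = card (joins n X)"
  have K: "xs k = []" if "K \<le> k" for k
    using radical_resolution_finite_length[OF R finite_joins[OF X(1)] G] that unfolding K_def by blast
  have sum_eq: "(\<Sum>k | Q k \<and> xs k \<noteq> []. mset (xs k)) = (\<Sum>k<K. if Q k then mset (xs k) else {#})" for Q
  proof (rule sum.mono_neutral_cong_left)
    show "{k. Q k \<and> xs k \<noteq> []} \<subseteq> {..<K}" using K by (auto simp: not_le[symmetric])
  qed auto
  have \<beta>: "betti_signed_barcode n M = (\<Sum>k<K. if even k then mset (xs k) else {#},
      \<Sum>k<K. if odd k then mset (xs k) else {#})"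
    unfolding betti_signed_barcode_eq[OF M R] sum_eq ..
  have xs: "set (xs k) \<subseteq> Rn n" for k using R unfolding radical_resolution_def by blast
  have P: "projective_resolution n M (\<lambda>k. free_sum (xs k)) d e"
    using R unfolding radical_resolution_def by blast
  let ?S = "insert (0\<^sub>v n) (joins n X)"
  define t where "t = join n ?S"
  have S: "finite ?S" "?S \<subseteq> Rn n" using finite_joins[OF X(1)] joins_subset_Rn by auto
  have t: "t \<in> Rn n" unfolding t_def by (rule join_in_Rn)
  have le_t: "g \<le> t" if "g \<in> joins n X" for g
    using join_le_iff[OF S(1) _ S(2) t] that unfolding t_def by auto
  show "betti_signed_barcode n M \<in> signed_barcodes n"
    unfolding \<beta> signed_barcodes_def barcodes_def using xs
    by (auto simp: set_mset_sum subset_iff split: if_splits)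
  have "kvs.dim (obj M r) + size (snd (betti_signed_barcode n M)) =
      size (fst (betti_signed_barcode n M))" if r: "r \<in> Rn n" "t \<le> r" for r
  proof -
    have top: "g \<le> r" if "g \<in> set (xs k)" for g k
      using le_t[of g] G that r(2) order_trans by blast
    have size: "size (\<Sum>k<K. if Q k then mset (xs k) else {#}) =
        (\<Sum>k<K. if Q k then length (xs k) else 0)" for Q
      unfolding size_sum by (rule sum.cong) auto
    show ?thesis
      unfolding \<beta> fst_conv snd_conv size
      by (rule resolution_euler_characteristic[OF P r(1) top K[OF order_refl]])
  qed
  moreover have "bij_betw (str M r s) (obj M r) (obj M s)"
    if rs: "r \<in> Rn n" "s \<in> Rn n" "t \<le> r" "r \<le> s" for r s
  proof (rule tame_bij[OF tame rs(1,2,4)])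
    fix x assume "x \<in> X"
    then have "x \<le> t" using le_t[of x] subset_joins[OF X(2)] by blast
    then show "x \<le> r" using rs(3) by (rule order_trans)
  qed
  ultimately show "\<exists>t\<in>Rn n. \<forall>r\<in>Rn n. t \<le> r \<longrightarrow>
      kvs.dim (obj M r) + size (snd (betti_signed_barcode n M)) = size (fst (betti_signed_barcode n M)) \<and>
      (\<forall>s\<in>Rn n. r \<le> s \<longrightarrow> bij_betw (str M r s) (obj M r) (obj M s))"
    using t by blast
qed

subsection \<open>Interleaved modules have the same eventual dimension\<close>

lemma diag_in_Rn: "diag n \<epsilon> \<in> Rn n"
  unfolding diag_def by simp

lemma le_add_diag: "r \<in> Rn n \<Longrightarrow> 0 \<le> \<epsilon> \<Longrightarrow> r \<le> r + diag n \<epsilon>"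
  unfolding diag_def less_eq_vec_def by auto

text \<open>
  The composite of the interleaving morphisms is a structure map; where this is injective, so is
  the first of the two morphisms.
\<close>

lemma interleaved_dim_le:
  assumes M: "persistence_module n M" and N: "persistence_module n N"
    and il: "interleaved n \<epsilon> M N" and \<epsilon>: "0 \<le> \<epsilon>" and r: "r \<in> Rn n"
    and inj: "inj_on (str M r (r + diag n (2 * \<epsilon>))) (obj M r)"
  shows "kvs.dim (obj M r) \<le> kvs.dim (obj N (r + diag n \<epsilon>))"
proof -
  let ?s = "r + diag n \<epsilon>" and ?t = "r + diag n (2 * \<epsilon>)"
  have s: "?s \<in> Rn n" "?t \<in> Rn n" using r diag_in_Rn by auto
  have rt: "r \<le> ?t" using le_add_diag r \<epsilon> by simp
  obtain f g where f: "pmod_hom n M (shift n \<epsilon> N) f" and g: "pmod_hom n N (shift n \<epsilon> M) g"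
    and gf: "\<And>x. x \<in> obj M r \<Longrightarrow> g ?s (f r x) = str M r ?t x"
    using il r unfolding interleaved_def by blast
  have lin: "linear_map (obj M r) (obj N ?s) (f r)" using hom_lin[OF f r] by (simp add: shift_def)
  have "x = 0" if x: "x \<in> obj M r" "f r x = 0" for x
  proof -
    have "str M r ?t x = 0" using gf[OF x(1)] x(2) hom_zero[OF g N s(1)] by simp
    moreover have "str M r ?t 0 = 0"
      by (rule linear_map_zero[OF pm_str[OF M r s(2) rt] pm_subspace[OF M r]])
    ultimately show "x = 0"
      using inj_onD[OF inj _ x(1) kvs.subspace_0[OF pm_subspace[OF M r]]] by simp
  qed
  then show ?thesis by (rule dim_le_if_injective[OF lin pm_fd[OF M r] pm_fd[OF N s(1)]])
qed

lemma interleaved_sym: "interleaved n \<epsilon> M N \<Longrightarrow> interleaved n \<epsilon> N M"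
  unfolding interleaved_def by blast

lemma interleaved_rank_le:
  fixes M N :: "'k::field pmod"
  assumes M: "finitely_presentable n M" and N: "finitely_presentable n N"
    and il: "interleaved n \<epsilon> M N" and \<epsilon>: "0 \<le> \<epsilon>"
  shows "size (fst (betti_signed_barcode n M)) + size (snd (betti_signed_barcode n N)) \<le>
    size (fst (betti_signed_barcode n N)) + size (snd (betti_signed_barcode n M))"
proof -
  have pm: "persistence_module n M" "persistence_module n N"
    using M N unfolding finitely_presentable_def by auto
  obtain t where t: "t \<in> Rn n" and M_t: "\<forall>r\<in>Rn n. t \<le> r \<longrightarrow>
      kvs.dim (obj M r) + size (snd (betti_signed_barcode n M)) = size (fst (betti_signed_barcode n M)) \<and>
      (\<forall>s\<in>Rn n. r \<le> s \<longrightarrow> bij_betw (str M r s) (obj M r) (obj M s))"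
    using betti_signed_barcode_rank(2)[OF M] by (rule bexE)
  obtain u where u: "u \<in> Rn n" and N_u: "\<forall>r\<in>Rn n. u \<le> r \<longrightarrow>
      kvs.dim (obj N r) + size (snd (betti_signed_barcode n N)) = size (fst (betti_signed_barcode n N)) \<and>
      (\<forall>s\<in>Rn n. r \<le> s \<longrightarrow> bij_betw (str N r s) (obj N r) (obj N s))"
    using betti_signed_barcode_rank(2)[OF N] by (rule bexE)
  define r where "r = join n {t, u}"
  have r: "r \<in> Rn n" unfolding r_def by (rule join_in_Rn)
  have tr: "t \<le> r" "u \<le> r" using join_le_iff[of "{t, u}" n r] t u r unfolding r_def by auto
  have s: "r + diag n \<epsilon> \<in> Rn n" "r + diag n (2 * \<epsilon>) \<in> Rn n" using r diag_in_Rn by auto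
  have "inj_on (str M r (r + diag n (2 * \<epsilon>))) (obj M r)"
    using M_t r tr(1) s(2) le_add_diag[OF r, of "2 * \<epsilon>"] \<epsilon> by (auto simp: bij_betw_def)
  then have "kvs.dim (obj M r) \<le> kvs.dim (obj N (r + diag n \<epsilon>))"
    using interleaved_dim_le[OF pm il \<epsilon> r] by blast
  moreover have "u \<le> r + diag n \<epsilon>" using tr(2) le_add_diag[OF r \<epsilon>] order_trans by blast
  ultimately show ?thesis using M_t r tr(1) N_u s(1) by force
qed

section \<open>Sums of short bars\<close>

definition alive :: "real vec list \<Rightarrow> real vec list \<Rightarrow> real vec \<Rightarrow> nat set" where
  "alive xs ys r = {m \<in> below xs r. \<not> ys ! m \<le> r}"

definition truncate :: "nat set \<Rightarrow> (nat \<Rightarrow> 'k::field) \<Rightarrow> nat \<Rightarrow> 'k" where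
  "truncate S v = (\<lambda>m. if m \<in> S then v m else 0)"

text \<open>
  The direct sum of the cokernels of the inclusions \<open>F (ys ! m) \<rightarrow> F (xs ! m)\<close>, where
  \<open>xs ! m < ys ! m\<close>: the \<open>m\<close>-th coordinate is present at the points that dominate \<open>xs ! m\<close> but
  not \<open>ys ! m\<close>.
\<close>

definition bars :: "real vec list \<Rightarrow> real vec list \<Rightarrow> 'k::field pmod" where
  "bars xs ys = \<lparr>obj = (\<lambda>r. coord_space (alive xs ys r)), str = (\<lambda>r s. truncate (alive xs ys s))\<rparr>"

lemma bars_simps [simp]:
  "obj (bars xs ys) r = coord_space (alive xs ys r)"
  "str (bars xs ys) r s = truncate (alive xs ys s)"
  unfolding bars_def by simp_all

lemma linear_map_truncate: "linear_map V (coord_space S) (truncate S)"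
  unfolding linear_map_def truncate_def coord_space_def by (auto simp: fun_eq_iff vscale_def)

lemma truncate_id: "v \<in> coord_space S \<Longrightarrow> truncate S v = v"
  unfolding truncate_def coord_space_def by (auto simp: fun_eq_iff)

lemma alive_convex: "r \<le> s \<Longrightarrow> s \<le> t \<Longrightarrow> m \<in> alive xs ys r \<Longrightarrow> m \<in> alive xs ys t \<Longrightarrow> m \<in> alive xs ys s"
  unfolding alive_def by (auto intro: order_trans)

lemma pm_bars: "persistence_module n (bars xs ys)"
  unfolding persistence_module_def bars_simps
proof (intro conjI ballI impI)
  fix r s t :: "real vec" and v :: "nat \<Rightarrow> 'a"
  assume "r \<le> s" "s \<le> t" "v \<in> coord_space (alive xs ys r)"
  then show "truncate (alive xs ys t) (truncate (alive xs ys s) v) = truncate (alive xs ys t) v"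
    using alive_convex[of r s t _ xs ys] by (auto simp: truncate_def coord_space_def fun_eq_iff)
qed (auto simp: linear_map_truncate truncate_id alive_def intro: fd_coord_space)

context
  fixes n :: nat and xs ys :: "real vec list"
  assumes len: "length xs = length ys" and xs: "set xs \<subseteq> Rn n" and ys: "set ys \<subseteq> Rn n"
    and less: "\<And>m. m < length xs \<Longrightarrow> xs ! m \<le> ys ! m \<and> xs ! m \<noteq> ys ! m"
begin

lemma below_strict: "m \<in> below ys r \<Longrightarrow> m \<in> below xs r \<and> xs ! m \<noteq> r"
  using less[of m] len by (auto intro: order_trans dest: order.antisym)

text \<open>
  The inclusion of the free module on \<open>ys\<close> into the one on \<open>xs\<close> has radical values because
  \<open>xs ! m \<noteq> ys ! m\<close>, so this two-term resolution is minimal.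
\<close>

lemma radical_resolution_bars:
  "radical_resolution n (bars xs ys :: 'k::field pmod)
    (\<lambda>k. if k = 0 then xs else if k = 1 then ys else [])
    (\<lambda>k r v. if k = 0 then v else 0) (\<lambda>r. truncate (alive xs ys r))"
    (is "radical_resolution n _ ?X ?d ?e")
proof -
  have nil: "obj (free_sum [] :: 'k pmod) r = {0}" for r
    by (auto simp: obj_free_sum coord_space_def fun_eq_iff)
  have zero: "0 \<in> obj (free_sum ys :: 'k pmod) r" for r
    unfolding obj_free_sum by (rule kvs.subspace_0[OF subspace_coord_space])
  have X: "set (?X k) \<subseteq> Rn n" for k using xs ys by auto
  have sub: "coord_space (below ys r) \<subseteq> (coord_space {m \<in> below xs r. xs ! m \<noteq> r} :: (nat \<Rightarrow> 'k) set)" for r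
    using below_strict[of _ r] by (auto simp: coord_space_def)
  have sub': "coord_space (below ys r) \<subseteq> (coord_space (below xs r) :: (nat \<Rightarrow> 'k) set)" for r
    using below_strict[of _ r] by (auto simp: coord_space_def)
  have proj: "projective n (free_sum (?X k) :: 'k pmod)" for k by (rule projective_free_sum[OF X])
  have hom: "pmod_hom n (free_sum (?X (Suc k))) (free_sum (?X k) :: 'k pmod) (?d k)" for k
    using sub' kvs.subspace_0[OF subspace_coord_space]
    by (cases k) (auto simp: pmod_hom_def linear_map_def nil obj_free_sum)
  have "pmod_hom n (free_sum xs) (bars xs ys) (?e :: 'k pmor)"
    unfolding pmod_hom_def
  proof (intro conjI ballI impI)
    fix r s and v :: "nat \<Rightarrow> 'k" assume "r \<le> s" and v: "v \<in> obj (free_sum xs) r"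
    then have "m \<in> alive xs ys r" if "v m \<noteq> 0" "m \<in> alive xs ys s" for m
      using that unfolding obj_free_sum coord_space_def alive_def by (auto intro: order_trans)
    then show "truncate (alive xs ys s) (str (free_sum xs) r s v) =
        str (bars xs ys) r s (truncate (alive xs ys r) v)"
      by (auto simp: truncate_def fun_eq_iff)
  qed (simp add: linear_map_truncate)
  moreover have "?e r ` obj (free_sum xs) r = (coord_space (alive xs ys r) :: (nat \<Rightarrow> 'k) set)" for r
  proof
    show "?e r ` obj (free_sum xs) r \<subseteq> (coord_space (alive xs ys r) :: (nat \<Rightarrow> 'k) set)"
      by (auto simp: truncate_def coord_space_def)
    show "(coord_space (alive xs ys r) :: (nat \<Rightarrow> 'k) set) \<subseteq> ?e r ` obj (free_sum xs) r"
    proof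
      fix v :: "nat \<Rightarrow> 'k" assume v: "v \<in> coord_space (alive xs ys r)"
      then have "v \<in> obj (free_sum xs) r" unfolding obj_free_sum coord_space_def alive_def by auto
      then show "v \<in> ?e r ` obj (free_sum xs) r" using truncate_id[OF v] by (metis imageI)
    qed
  qed
  ultimately have epi: "pmod_epi n (free_sum (?X 0)) (bars xs ys) (?e :: 'k pmor)"
    unfolding pmod_epi_def by simp
  have ex0: "exact_at n (free_sum (?X 1)) (?d 0) (free_sum (?X 0)) (?e :: 'k pmor)"
    unfolding exact_at_def
  proof
    fix r
    have "truncate (alive xs ys r) v = 0 \<longleftrightarrow> v \<in> coord_space (below ys r)"
      if "v \<in> coord_space (below xs r)" for v :: "nat \<Rightarrow> 'k"
      using that len by (auto simp: truncate_def coord_space_def alive_def fun_eq_iff)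
    then show "?d 0 r ` obj (free_sum (?X 1)) r =
        {v \<in> obj (free_sum (?X 0)) r. truncate (alive xs ys r) v = (0 :: nat \<Rightarrow> 'k)}"
      using sub' by (auto simp: obj_free_sum)
  qed
  have ex: "exact_at n (free_sum (?X (Suc (Suc k)))) (?d (Suc k)) (free_sum (?X (Suc k)) :: 'k pmod) (?d k)"
    for k
    unfolding exact_at_def
    using zero by (cases k) (auto simp: nil)
  have "projective_resolution n (bars xs ys :: 'k pmod) (\<lambda>k. free_sum (?X k)) ?d ?e"
    unfolding projective_resolution_def using proj hom epi ex0 ex by blast
  moreover have "?d k r ` obj (free_sum (?X (Suc k))) r \<subseteq> radical n (free_sum (?X k) :: 'k pmod) r"
    if "r \<in> Rn n" for k r
  proof (cases k)
    case 0
    then show ?thesis using sub radical_free_sum[OF xs that] by (auto simp: obj_free_sum)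
  next
    case (Suc j)
    then show ?thesis using kvs.subspace_0[OF subspace_radical] by auto
  qed
  ultimately show ?thesis unfolding radical_resolution_def using X by blast
qed

lemma finitely_presentable_bars: "finitely_presentable n (bars xs ys :: 'k::field pmod)"
proof -
  have "projective_resolution n (bars xs ys :: 'k pmod)
    (\<lambda>k. free_sum (if k = 0 then xs else if k = 1 then ys else []))
    (\<lambda>k r v. if k = 0 then v else 0) (\<lambda>r. truncate (alive xs ys r))"
    using radical_resolution_bars unfolding radical_resolution_def by blast
  note P = this[unfolded projective_resolution_def]
  have "pmod_hom n (free_sum ys) (free_sum xs :: 'k pmod) (\<lambda>r v. v)"
    using P[THEN conjunct2, THEN conjunct1, rule_format, of 0] by simp
  moreover have "pmod_epi n (free_sum xs) (bars xs ys :: 'k pmod) (\<lambda>r. truncate (alive xs ys r))"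
    "exact_at n (free_sum ys) (\<lambda>r v. v) (free_sum xs) (\<lambda>r. truncate (alive xs ys r) :: (nat \<Rightarrow> 'k) \<Rightarrow> _)"
    using P by simp_all
  ultimately show ?thesis
    unfolding finitely_presentable_def using pm_bars finite_free_free_sum xs ys by blast
qed

lemma betti_signed_barcode_bars:
  "betti_signed_barcode n (bars xs ys :: 'k::field pmod) = (mset xs, mset ys)"
proof -
  let ?X = "\<lambda>k::nat. if k = 0 then xs else if k = 1 then ys else []"
  have "(\<Sum>k | even k \<and> ?X k \<noteq> []. mset (?X k)) = (\<Sum>k\<in>{0}. mset (?X k))"
    by (rule sum.mono_neutral_left) (auto split: if_splits)
  moreover have "(\<Sum>k | odd k \<and> ?X k \<noteq> []. mset (?X k)) = (\<Sum>k\<in>{1}. mset (?X k))"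
    by (rule sum.mono_neutral_left) (auto split: if_splits)
  ultimately show ?thesis
    using betti_signed_barcode_eq[OF pm_bars radical_resolution_bars[where 'k = 'k]] by simp
qed

text \<open>All bars die within \<open>2 * \<delta>\<close>, so zero morphisms form an interleaving with the zero module.\<close>

lemma interleaving_distance_bars:
  assumes \<delta>: "0 \<le> \<delta>" and short: "\<And>m. m < length xs \<Longrightarrow> ys ! m \<le> xs ! m + diag n (2 * \<delta>)"
  shows "interleaving_distance n (bars xs ys) (bars [] [] :: 'k::field pmod) \<le> ennreal \<delta>"
proof -
  have dead: "m \<notin> alive xs ys (r + diag n (2 * \<delta>))" if "r \<in> Rn n" "m \<in> alive xs ys r" for m r
  proof -
    have m: "m < length xs" "xs ! m \<le> r" "xs ! m \<in> Rn n" using that xs by (auto simp: alive_def)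
    have "xs ! m + diag n (2 * \<delta>) \<le> r + diag n (2 * \<delta>)"
      using m(2,3) that(1) unfolding less_eq_vec_def diag_def by auto
    then show ?thesis using short[OF m(1)] by (auto simp: alive_def intro: order_trans)
  qed
  have "pmod_hom n (bars xs ys) (shift n \<delta> (bars [] [])) (\<lambda>r x. 0 :: nat \<Rightarrow> 'k)"
    "pmod_hom n (bars [] []) (shift n \<delta> (bars xs ys)) (\<lambda>r x. 0 :: nat \<Rightarrow> 'k)"
    by (auto simp: pmod_hom_def linear_map_def shift_def coord_space_def truncate_def fun_eq_iff)
  moreover have "0 = truncate (alive xs ys (r + diag n (2 * \<delta>))) v"
    if "r \<in> Rn n" "v \<in> coord_space (alive xs ys r)" for r and v :: "nat \<Rightarrow> 'k"
    using dead[OF that(1)] that(2) by (auto simp: truncate_def coord_space_def fun_eq_iff)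
  moreover have "0 = truncate (alive [] [] s) v" for s and v :: "nat \<Rightarrow> 'k"
    by (auto simp: truncate_def alive_def fun_eq_iff)
  ultimately have "interleaved n \<delta> (bars xs ys) (bars [] [] :: 'k pmod)"
    unfolding interleaved_def by (intro exI[of _ "\<lambda>r x. 0"]) simp
  then show ?thesis unfolding interleaving_distance_def using \<delta> by (intro Inf_lower) blast
qed

end

section \<open>Stable balanced dissimilarities only see the rank\<close>

context
  fixes n :: nat and d :: "signed_barcode \<Rightarrow> signed_barcode \<Rightarrow> ennreal"
  assumes dissim: "dissimilarity_on (signed_barcodes n) d"
    and bal: "balanced_dissimilarity n d"
    and tri: "triangle_inequality_on (signed_barcodes n) d"
begin

lemma dissimilarity_self: "a \<in> signed_barcodes n \<Longrightarrow> d a a = 0"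
  and dissimilarity_sym: "a \<in> signed_barcodes n \<Longrightarrow> b \<in> signed_barcodes n \<Longrightarrow> d a b = d b a"
  and triangle: "a \<in> signed_barcodes n \<Longrightarrow> b \<in> signed_barcodes n \<Longrightarrow> c \<in> signed_barcodes n \<Longrightarrow>
    d a c \<le> d a b + d b c"
  using dissim tri unfolding dissimilarity_on_def triangle_inequality_on_def by blast+

lemma signed_barcodes_iff: "(A, B) \<in> signed_barcodes n \<longleftrightarrow> A \<in> barcodes n \<and> B \<in> barcodes n"
  unfolding signed_barcodes_def by simp

lemma barcodes_empty: "{#} \<in> barcodes n"
  and barcodes_add: "A + B \<in> barcodes n \<longleftrightarrow> A \<in> barcodes n \<and> B \<in> barcodes n"
  and barcodes_add_mset: "add_mset a A \<in> barcodes n \<longleftrightarrow> a \<in> Rn n \<and> A \<in> barcodes n"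
  unfolding barcodes_def by auto

lemma balance:
  "A \<in> barcodes n \<Longrightarrow> B \<in> barcodes n \<Longrightarrow> C \<in> barcodes n \<Longrightarrow> C' \<in> barcodes n \<Longrightarrow>
    d (A, B) (C, C') = d (A, {#}) (C + B, C')"
  using bal barcodes_empty unfolding balanced_dissimilarity_def signed_barcodes_iff
  by (metis add_0)

text \<open>
  The signed barcode \<open>(A + D, D)\<close> is at distance zero from \<open>(A, \<emptyset>)\<close> by balancedness. Passing
  through it, points common to two barcodes cancel.
\<close>

lemma cancel_common_points:
  assumes "A \<in> barcodes n" "C \<in> barcodes n" "D \<in> barcodes n"
  shows "d (A + D, {#}) (C + D, {#}) = d (A, {#}) (C, {#})"
proof -
  have mem: "(A + D, D) \<in> signed_barcodes n" "(A, {#}) \<in> signed_barcodes n"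
    "(C, {#}) \<in> signed_barcodes n" "(A + D, {#}) \<in> signed_barcodes n"
    using assms barcodes_empty by (simp_all add: signed_barcodes_iff barcodes_add)
  have AD: "A + D \<in> barcodes n" using assms by (simp add: barcodes_add)
  have bal_C: "d (A + D, D) (C, {#}) = d (A + D, {#}) (C + D, {#})"
    by (rule balance[OF AD assms(3) assms(2) barcodes_empty])
  have "d (A + D, D) (A, {#}) = d (A + D, {#}) (A + D, {#})"
    by (rule balance[OF AD assms(3) assms(1) barcodes_empty])
  then have zero: "d (A + D, D) (A, {#}) = 0" using dissimilarity_self[OF mem(4)] by simp
  have "d (A + D, D) (C, {#}) \<le> d (A, {#}) (C, {#})"
    using triangle[OF mem(1,2,3)] zero by simp
  moreover have "d (A, {#}) (C, {#}) \<le> d (A + D, D) (C, {#})"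
    using triangle[OF mem(2,1,3)] zero dissimilarity_sym[OF mem(1,2)] by simp
  ultimately show ?thesis using bal_C by simp
qed

text \<open>
  The Lipschitz bound from a single bar between \<open>i\<close> and \<open>j\<close> would only give the length of the bar.
  Instead, walk from \<open>i\<close> to \<open>j\<close> in \<open>k\<close> equal steps. The \<open>k\<close> bars between consecutive points are all
  short, so their sum is close to zero in the interleaving distance, no matter how many there are.
  Its barcodes are the points of the walk without the last and without the first one; after
  cancelling the common points only \<open>i\<close> and \<open>j\<close> remain.
\<close>

lemma dissimilarity_comparable_points:
  assumes st: "stable_dissimilarity TYPE('k::field) n d"
    and i: "i \<in> Rn n" and j: "j \<in> Rn n" and ij: "i \<le> j"
  shows "d ({#i#}, {#}) ({#j#}, {#}) = 0"
proof (cases "i = j")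
  case True
  then show ?thesis
    using dissimilarity_self barcodes_empty i by (simp add: signed_barcodes_iff barcodes_add_mset)
next
  case False
  have dims: "dim_vec i = n" "dim_vec j = n" using i j by auto
  have ij': "i $ l \<le> j $ l" if "l < n" for l using ij that dims unfolding less_eq_vec_def by simp
  \<comment> \<open>any nonnegative bound on the coordinates of \<open>j - i\<close> will do; it bounds \<open>k\<close> times the step width\<close>
  define C where "C = (\<Sum>l<n. j $ l - i $ l)"
  have C: "j $ l - i $ l \<le> C" if "l < n" for l
    unfolding C_def using that ij' by (intro member_le_sum) auto
  have C0: "0 \<le> C" unfolding C_def using ij' by (intro sum_nonneg) auto
  have "d ({#i#}, {#}) ({#j#}, {#}) \<le> ennreal (C / real k)" if k: "0 < k" for k
  proof -
    define p where "p a = vec n (\<lambda>l. i $ l + real a / real k * (j $ l - i $ l))" for a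
    define D where "D = mset (map p [1..<k])"
    let ?xs = "map p [0..<k]" and ?ys = "map p [1..<Suc k]"
    have p: "p a \<in> Rn n" for a unfolding p_def by simp
    have p_ends: "p 0 = i" "p k = j" unfolding p_def using k dims by (auto intro!: eq_vecI)
    have nth: "?xs ! m = p m" "?ys ! m = p (Suc m)" if "m < k" for m
      using that by (simp_all del: upt_Suc)
    have mono: "p m \<le> p (Suc m) \<and> p m \<noteq> p (Suc m)" for m
    proof
      show "p m \<le> p (Suc m)"
        unfolding p_def less_eq_vec_def using ij' k
        by (auto intro!: mult_right_mono divide_right_mono)
      obtain l where l: "l < n" "i $ l \<noteq> j $ l" using False dims by (metis eq_vecI)
      then have "p m $ l \<noteq> p (Suc m) $ l" unfolding p_def using k by (simp add: field_simps)
      then show "p m \<noteq> p (Suc m)" by metis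
    qed
    have short: "p (Suc m) \<le> p m + diag n (2 * (C / real k))" for m
      unfolding less_eq_vec_def
    proof (intro conjI allI impI)
      fix l assume "l < dim_vec (p m + diag n (2 * (C / real k)))"
      then have l: "l < n" by (simp add: diag_def)
      have "p (Suc m) $ l = p m $ l + (j $ l - i $ l) / real k"
        using l k unfolding p_def by (simp add: field_simps)
      also have "(j $ l - i $ l) / real k \<le> C / real k"
        using C[OF l] by (intro divide_right_mono) auto
      also have "\<dots> \<le> 2 * (C / real k)" using divide_nonneg_nonneg[OF C0, of "real k"] by simp
      finally show "p (Suc m) $ l \<le> (p m + diag n (2 * (C / real k))) $ l"
        using l by (simp add: diag_def p_def)
    qed (simp add: diag_def p_def)
    have len: "length ?xs = length ?ys" by simp
    have Rn: "set ?xs \<subseteq> Rn n" "set ?ys \<subseteq> Rn n" using p by auto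
    have less: "?xs ! m \<le> ?ys ! m \<and> ?xs ! m \<noteq> ?ys ! m" if "m < length ?xs" for m
      using nth[of m] mono[of m] that by simp
    let ?M = "bars ?xs ?ys :: 'k pmod" and ?Z = "bars [] [] :: 'k pmod"
    have "d (betti_signed_barcode n ?M) (betti_signed_barcode n ?Z) \<le> interleaving_distance n ?M ?Z"
      using st finitely_presentable_bars[OF len Rn less, where 'k = 'k]
        finitely_presentable_bars[of "[]" "[]" n, where 'k = 'k]
      unfolding stable_dissimilarity_def by simp
    also have "\<dots> \<le> ennreal (C / real k)"
    proof (rule interleaving_distance_bars[OF len Rn less])
      fix m assume "m < length ?xs"
      then show "?ys ! m \<le> ?xs ! m + diag n (2 * (C / real k))" using nth[of m] short[of m] by simp
    qed (use C0 in auto)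
    also have "betti_signed_barcode n ?M = (mset ?xs, mset ?ys)"
      by (rule betti_signed_barcode_bars[OF len Rn less])
    also have "betti_signed_barcode n ?Z = ({#}, {#})"
      using betti_signed_barcode_bars[of "[]" "[]" n, where 'k = 'k] by simp
    also have "mset ?xs = {#i#} + D"
      unfolding D_def using k p_ends by (simp add: upt_conv_Cons)
    also have "mset ?ys = {#j#} + D"
      unfolding D_def using k p_ends by simp
    finally have "d ({#i#} + D, {#j#} + D) ({#}, {#}) \<le> ennreal (C / real k)" .
    moreover have D: "D \<in> barcodes n" unfolding D_def barcodes_def using p by auto
    ultimately have "d ({#i#} + D, {#}) ({#j#} + D, {#}) \<le> ennreal (C / real k)"
      using balance[of "{#i#} + D" "{#j#} + D" "{#}" "{#}"] i j
      by (simp add: barcodes_add barcodes_add_mset barcodes_empty)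
    then show ?thesis
      using cancel_common_points[of "{#i#}" "{#j#}" D] D i j
      by (simp add: barcodes_add_mset barcodes_empty)
  qed
  then have "d ({#i#}, {#}) ({#j#}, {#}) \<le> ennreal (C / real (Suc k))" for k by blast
  moreover have "(\<lambda>k. ennreal (C / real (Suc k))) \<longlonglongrightarrow> ennreal 0"
    by (intro tendsto_ennrealI LIMSEQ_Suc lim_const_over_n)
  ultimately have "d ({#i#}, {#}) ({#j#}, {#}) \<le> ennreal 0"
    by (intro LIMSEQ_le_const) auto
  then show ?thesis by simp
qed

text \<open>Two arbitrary points are both comparable to their join.\<close>

lemma dissimilarity_points:
  assumes st: "stable_dissimilarity TYPE('k::field) n d" and i: "i \<in> Rn n" and j: "j \<in> Rn n"
  shows "d ({#i#}, {#}) ({#j#}, {#}) = 0"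
proof -
  define b where "b = join n {i, j}"
  have b: "b \<in> Rn n" unfolding b_def by (rule join_in_Rn)
  have le: "i \<le> b" "j \<le> b" using join_le_iff[of "{i, j}" n b] i j b unfolding b_def by auto
  have mem: "({#a#}, {#}) \<in> signed_barcodes n" if "a \<in> Rn n" for a
    using that by (simp add: signed_barcodes_iff barcodes_add_mset barcodes_empty)
  have "d ({#i#}, {#}) ({#j#}, {#}) \<le> d ({#i#}, {#}) ({#b#}, {#}) + d ({#b#}, {#}) ({#j#}, {#})"
    by (rule triangle[OF mem[OF i] mem[OF b] mem[OF j]])
  also have "\<dots> = 0"
    using dissimilarity_comparable_points[OF st i b le(1)]
      dissimilarity_comparable_points[OF st j b le(2)] dissimilarity_sym[OF mem[OF b] mem[OF j]] by simp
  finally show ?thesis by simp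
qed

lemma dissimilarity_equal_size:
  assumes st: "stable_dissimilarity TYPE('k::field) n d"
    and "A \<in> barcodes n" "C \<in> barcodes n" "size A = size C"
  shows "d (A, {#}) (C, {#}) = 0"
  using assms(2-)
proof (induction A arbitrary: C)
  case empty
  then show ?case using dissimilarity_self by (simp add: signed_barcodes_iff)
next
  case (add a A)
  from add.prems(3) obtain c C' where C: "C = add_mset c C'"
    by (metis multi_nonempty_split size_add_mset size_empty nat.distinct(1))
  have ac: "a \<in> Rn n" "c \<in> Rn n" "A \<in> barcodes n" "C' \<in> barcodes n"
    using add.prems C by (auto simp: barcodes_add_mset)
  note mem = signed_barcodes_iff barcodes_add barcodes_add_mset barcodes_empty
  have "d ({#a#} + A, {#}) ({#c#} + C', {#}) \<le>
      d ({#a#} + A, {#}) ({#c#} + A, {#}) + d (A + {#c#}, {#}) (C' + {#c#}, {#})"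
    using triangle[of "({#a#} + A, {#})" "({#c#} + A, {#})" "({#c#} + C', {#})"] ac
    by (simp add: mem)
  also have "\<dots> = d ({#a#}, {#}) ({#c#}, {#}) + d (A, {#}) (C', {#})"
    using cancel_common_points[of "{#a#}" "{#c#}" A] cancel_common_points[of A C' "{#c#}"] ac
    by (simp add: mem)
  also have "\<dots> = 0"
    using dissimilarity_points[OF st ac(1,2)] add.IH[OF ac(3,4)] add.prems(3) C by simp
  finally show ?case using C by simp
qed

end

theorem proposition1p4:
  fixes n :: nat
    and d :: "signed_barcode \<Rightarrow> signed_barcode \<Rightarrow> ennreal"
    and M N :: "'k::field pmod"
  assumes "dissimilarity_on (signed_barcodes n) d"
    and "stable_dissimilarity TYPE('k) n d"
    and "balanced_dissimilarity n d"
    and "triangle_inequality_on (signed_barcodes n) d"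
    and "finitely_presentable n M"
    and "finitely_presentable n N"
    and "interleaving_distance n M N < \<infinity>"
  shows "d (betti_signed_barcode n M) (betti_signed_barcode n N) = 0"
proof -
  note ctxt = assms(1,3,4)
  have "{ennreal \<epsilon> | \<epsilon>. \<epsilon> \<ge> 0 \<and> interleaved n \<epsilon> M N} \<noteq> {}"
  proof
    assume "{ennreal \<epsilon> | \<epsilon>. \<epsilon> \<ge> 0 \<and> interleaved n \<epsilon> M N} = {}"
    then show False using assms(7) unfolding interleaving_distance_def by (simp only: Inf_empty) simp
  qed
  then obtain \<epsilon> where \<epsilon>: "0 \<le> \<epsilon>" "interleaved n \<epsilon> M N" by blast
  obtain A A' where A: "betti_signed_barcode n M = (A, A')" by fastforce
  obtain C C' where C: "betti_signed_barcode n N = (C, C')" by fastforce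
  have "(A, A') \<in> signed_barcodes n" "(C, C') \<in> signed_barcodes n"
    unfolding A[symmetric] C[symmetric] by (rule betti_signed_barcode_rank(1)[OF assms(5)],
        rule betti_signed_barcode_rank(1)[OF assms(6)])
  then have mem: "A \<in> barcodes n" "A' \<in> barcodes n" "C \<in> barcodes n" "C' \<in> barcodes n"
    by (simp_all add: signed_barcodes_def)
  have mem': "A + C' \<in> barcodes n" "C + A' \<in> barcodes n" "{#} \<in> barcodes n"
    using mem by (auto simp: barcodes_def)
  have "size (A + C') = size (C + A')"
    using interleaved_rank_le[OF assms(5,6) \<epsilon>(2,1)]
      interleaved_rank_le[OF assms(6,5) interleaved_sym[OF \<epsilon>(2)] \<epsilon>(1)] A C by simp
  have "d (A, A') (C, C') = d (A, {#}) (C + A', C')"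
    by (rule balance[OF ctxt mem(1,2,3,4)])
  also have "\<dots> = d (C + A', C') (A, {#})"
    using mem mem' by (intro dissimilarity_sym[OF ctxt]) (auto simp: signed_barcodes_def)
  also have "\<dots> = d (C + A', {#}) (A + C', {#})"
    by (rule balance[OF ctxt mem'(2) mem(4) mem(1) mem'(3)])
  also have "\<dots> = 0"
    using dissimilarity_equal_size[OF ctxt assms(2) mem'(2,1)] \<open>size (A + C') = size (C + A')\<close> by simp
  finally show ?thesis unfolding A C .
qed

end
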